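(* For every $\varepsilon>0$ there exists $\delta>0$ such that, for the billiard in the square $S=[-1/2,1/2]^2$ with one obstacle $O$, the admissible rotation set $AR$ contains the interval $[-\sqrt{2}/4+\varepsilon,\ \sqrt{2}/4-\varepsilon]$ whenever the obstacle $O$ is contained in a disk centered at the origin of diameter less than $\delta$.
   Context: Setting: $O\subset S$ is a compact convex set with nonempty interior and smooth boundary. Billiard trajectories in $S\setminus\operatorname{int}O$ move with unit speed along straight lines and reflect from the sides of $S$ and from $\partial O$ with angle of incidence equal to angle of reflection; a trajectory reaching a vertex of $S$ returns along the same line. Time along a trajectory piece equals its length. A tangency to the obstacle is not counted as a reflection. Unfolding: cover $\mathbb{R}^2$ by the squares $S+\mathbf{k}$, $\mathbf{k}\in\mathbb{Z}^2$, obtained from $S$ by consecutive reflections in the lines $x=n+1/2$, $y=n+1/2$, $n\in\mathbb{Z}$. For $\mathbf{k}=(p,q)$ the obstacle in $S+\mathbf{k}$ is $O_{\mathbf{k}}=\{(p+(-1)^p x,\,q+(-1)^q y):(x,y)\in O\}$. Trajectories in $S$ with obstacle $O$ unfold to billiard trajectories in $\mathbb{R}^2$ with obstacles $O_{\mathbf{k}}$. Admissibility: $O_{\mathbf{k}}$ is between $O_{\mathbf{i}}$ and $O_{\mathbf{j}}$ if $\mathbf{k}\ne\mathbf{i},\mathbf{j}$ and $O_{\mathbf{k}}$ intersects the convex hull of $O_{\mathbf{i}}\cup O_{\mathbf{j}}$. A (finite or infinite) sequence $(\mathbf{k}_n)_{n\ge 0}$ in $\mathbb{Z}^2$ is admissible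 if (1) $\mathbf{k}_0=\mathbf{0}$; (2) $\mathbf{k}_{n+1}\ne\mathbf{k}_n$ for every $n$; (3) for every $n$ there is no obstacle between $O_{\mathbf{k}_n}$ and $O_{\mathbf{k}_{n+1}}$; (4) for every $n$ the obstacle $O_{\mathbf{k}_{n+1}}$ is not between $O_{\mathbf{k}_n}$ and $O_{\mathbf{k}_{n+2}}$. A trajectory piece starting and ending on $\partial O$ has type $(\mathbf{k}_n)_{n=0}^s$ if its unfolding starts on the boundary of $O_{\mathbf{k}_0}=O_{\mathbf{0}}$, reflects consecutively from $O_{\mathbf{k}_1},\dots,O_{\mathbf{k}_{s-1}}$ and ends on the boundary of $O_{\mathbf{k}_s}$. Displacement: fix a point $\mathbf{z}$ in the interior of $O$ and set $\phi(\mathbf{x})=\arg(\mathbf{x}-\mathbf{z})/(2\pi)$, identifying $\mathbb{R}^2$ with $\mathbb{C}$; the displacement along a trajectory piece in $S$ is the (continuous) increment of $\phi$ along it. The admissible rotation set $AR$ is the set of all limits of sequences $d_n/t_n$, where $d_n$ and $t_n$ are the displacement and the length of a trajectory piece of admissible type, and $t_n\to\infty$ (it does not depend on the choice of $\mathbf{z}$). *)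

theory Defs
  imports "HOL-Analysis.Analysis"
begin

definition unit_square :: "complex set" where
  "unit_square = {w. \<bar>Re w\<bar> \<le> 1/2 \<and> \<bar>Im w\<bar> \<le> 1/2}"

text \<open>Smoothness of the boundary is read as class \<open>C\<^sup>1\<close>: the boundary is a
  closed regular \<open>C\<^sup>1\<close> curve, given by a periodic parametrisation.\<close>

definition smooth_boundary :: "complex set \<Rightarrow> bool" where
  "smooth_boundary A \<longleftrightarrow>
     (\<exists>c :: real \<Rightarrow> complex. c C1_differentiable_on UNIV \<and>
        (\<forall>t. vector_derivative c (at t) \<noteq> 0) \<and>
        (\<forall>t. c (t + 1) = c t) \<and>
        simple_path c \<and> path_image c = frontier A)"

definition obstacle :: "complex set \<Rightarrow> bool" where
  "obstacle A \<longleftrightarrow> compact A \<and> convex A \<and> interior A \<noteq> {} \<and> smooth_boundary A \<and>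
     A \<subseteq> unit_square"

text \<open>For a convex set with smooth boundary this determines \<open>n\<close> uniquely at every
  boundary point \<open>x\<close>.\<close>

definition outer_unit_normal :: "complex set \<Rightarrow> complex \<Rightarrow> complex \<Rightarrow> bool" where
  "outer_unit_normal A x n \<longleftrightarrow> norm n = 1 \<and> (\<forall>y\<in>A. inner (y - x) n \<le> 0)"

text \<open>Trajectories are parametrised by time, on an interval \<open>{0..T}\<close>. Since the speed is
  one, \<open>T\<close> is also the length.\<close>

definition departs :: "(real \<Rightarrow> complex) \<Rightarrow> real \<Rightarrow> complex \<Rightarrow> bool" where
  "departs \<gamma> t v \<longleftrightarrow> (\<exists>e>0. \<forall>h\<in>{0..e}. \<gamma> (t + h) = \<gamma> t + h *\<^sub>R v)"

definition arrives :: "(real \<Rightarrow> complex) \<Rightarrow> real \<Rightarrow> complex \<Rightarrow> bool" where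
  "arrives \<gamma> t u \<longleftrightarrow> (\<exists>e>0. \<forall>h\<in>{0..e}. \<gamma> (t - h) = \<gamma> t - h *\<^sub>R u)"

definition trajectory ::
  "complex set \<Rightarrow> (complex \<Rightarrow> complex \<Rightarrow> complex \<Rightarrow> bool) \<Rightarrow> real \<Rightarrow> (real \<Rightarrow> complex) \<Rightarrow> bool" where
  "trajectory D law T \<gamma> \<longleftrightarrow> 0 < T \<and> (\<forall>t\<in>{0..T}. \<gamma> t \<in> D) \<and>
     (\<exists>v. norm v = 1 \<and> departs \<gamma> 0 v) \<and>
     (\<exists>u. norm u = 1 \<and> arrives \<gamma> T u) \<and>
     (\<forall>t\<in>{0<..<T}. \<exists>u v. norm u = 1 \<and> norm v = 1 \<and>
        arrives \<gamma> t u \<and> departs \<gamma> t v \<and> law (\<gamma> t) u v)"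

text \<open>In the laws below, \<open>u\<close> and \<open>v\<close> are the velocities just before and just after the
  trajectory is at \<open>x\<close>. When \<open>u\<close> is tangent to the boundary, the reflection laws
  give \<open>v = u\<close>; so the condition \<open>u \<noteq> v\<close> in \<open>reflects_at\<close> is what excludes tangencies.\<close>

definition obstacle_law :: "complex set \<Rightarrow> complex \<Rightarrow> complex \<Rightarrow> complex \<Rightarrow> bool" where
  "obstacle_law A x u v \<longleftrightarrow> (\<exists>n. outer_unit_normal A x n \<and> v = u - (2 * inner u n) *\<^sub>R n)"

definition side_law :: "complex \<Rightarrow> complex \<Rightarrow> complex \<Rightarrow> bool" where
  "side_law x u v \<longleftrightarrow>
     (if \<bar>Re x\<bar> = 1/2 \<and> \<bar>Im x\<bar> = 1/2 then v = - u
      else if \<bar>Re x\<bar> = 1/2 then v = Complex (- Re u) (Im u)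
      else v = Complex (Re u) (- Im u))"

definition square_law :: "complex set \<Rightarrow> complex \<Rightarrow> complex \<Rightarrow> complex \<Rightarrow> bool" where
  "square_law A x u v \<longleftrightarrow>
     (x \<in> frontier A \<longrightarrow> obstacle_law A x u v) \<and>
     (x \<in> frontier unit_square \<longrightarrow> side_law x u v) \<and>
     (x \<notin> frontier A \<and> x \<notin> frontier unit_square \<longrightarrow> v = u)"

definition square_trajectory :: "complex set \<Rightarrow> real \<Rightarrow> (real \<Rightarrow> complex) \<Rightarrow> bool" where
  "square_trajectory A T \<gamma> \<longleftrightarrow> trajectory (unit_square - interior A) (square_law A) T \<gamma>"

definition reflects_at :: "(real \<Rightarrow> complex) \<Rightarrow> real \<Rightarrow> bool" where
  "reflects_at \<gamma> t \<longleftrightarrow> (\<exists>u v. arrives \<gamma> t u \<and> departs \<gamma> t v \<and> u \<noteq> v)"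

definition to_cell :: "int \<times> int \<Rightarrow> complex \<Rightarrow> complex" where
  "to_cell k w = Complex (of_int (fst k) + (-1) powi fst k * Re w)
                         (of_int (snd k) + (-1) powi snd k * Im w)"

definition obstacle_copy :: "complex set \<Rightarrow> int \<times> int \<Rightarrow> complex set" where
  "obstacle_copy A k = to_cell k ` A"

definition plane_law :: "complex set \<Rightarrow> complex \<Rightarrow> complex \<Rightarrow> complex \<Rightarrow> bool" where
  "plane_law A x u v \<longleftrightarrow>
     (\<forall>k. x \<in> frontier (obstacle_copy A k) \<longrightarrow> obstacle_law (obstacle_copy A k) x u v) \<and>
     ((\<forall>k. x \<notin> frontier (obstacle_copy A k)) \<longrightarrow> v = u)"

definition plane_trajectory :: "complex set \<Rightarrow> real \<Rightarrow> (real \<Rightarrow> complex) \<Rightarrow> bool" where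
  "plane_trajectory A T \<Gamma> \<longleftrightarrow>
     trajectory (- (\<Union>k. interior (obstacle_copy A k))) (plane_law A) T \<Gamma>"

definition unfolding_of :: "complex set \<Rightarrow> real \<Rightarrow> (real \<Rightarrow> complex) \<Rightarrow> (real \<Rightarrow> complex) \<Rightarrow> bool" where
  "unfolding_of A T \<gamma> \<Gamma> \<longleftrightarrow> plane_trajectory A T \<Gamma> \<and> (\<forall>t\<in>{0..T}. \<exists>k. \<Gamma> t = to_cell k (\<gamma> t))"

definition between :: "complex set \<Rightarrow> int \<times> int \<Rightarrow> int \<times> int \<Rightarrow> int \<times> int \<Rightarrow> bool" where
  "between A k i j \<longleftrightarrow> k \<noteq> i \<and> k \<noteq> j \<and>
     obstacle_copy A k \<inter> convex hull (obstacle_copy A i \<union> obstacle_copy A j) \<noteq> {}"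

text \<open>Finite sequences \<open>k\<^sub>0, \<dots>, k\<^sub>s\<close> are lists of length \<open>s + 1\<close>.\<close>

definition admissible :: "complex set \<Rightarrow> (int \<times> int) list \<Rightarrow> bool" where
  "admissible A ks \<longleftrightarrow> ks \<noteq> [] \<and> ks ! 0 = (0, 0) \<and>
     (\<forall>n. n + 1 < length ks \<longrightarrow> ks ! (n + 1) \<noteq> ks ! n) \<and>
     (\<forall>n. n + 1 < length ks \<longrightarrow> \<not> (\<exists>m. between A m (ks ! n) (ks ! (n + 1)))) \<and>
     (\<forall>n. n + 2 < length ks \<longrightarrow> \<not> between A (ks ! (n + 1)) (ks ! n) (ks ! (n + 2)))"

text \<open>Here \<open>\<tau> 1 < \<dots> < \<tau> (s - 1)\<close> enumerates all times strictly between \<open>0\<close> and \<open>T\<close> at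
  which the unfolding properly reflects.\<close>

definition has_type ::
  "complex set \<Rightarrow> real \<Rightarrow> (real \<Rightarrow> complex) \<Rightarrow> (int \<times> int) list \<Rightarrow> bool" where
  "has_type A T \<gamma> ks \<longleftrightarrow> ks \<noteq> [] \<and> ks ! 0 = (0, 0) \<and>
     \<gamma> 0 \<in> frontier A \<and> \<gamma> T \<in> frontier A \<and>
     (\<exists>\<Gamma> \<tau>. unfolding_of A T \<gamma> \<Gamma> \<and>
        (let s = length ks - 1 in
           \<tau> 0 = 0 \<and> \<tau> s = T \<and> strict_mono_on {0..s} \<tau> \<and>
           (\<forall>n\<le>s. \<Gamma> (\<tau> n) \<in> frontier (obstacle_copy A (ks ! n))) \<and>
           {t \<in> {0<..<T}. reflects_at \<Gamma> t} = \<tau> ` {0<..<s}))"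

text \<open>\<open>\<theta>\<close> is a continuous branch, along the trajectory, of the argument of \<open>\<gamma> t - z\<close>
  divided by \<open>2\<pi>\<close>.\<close>

definition displacement ::
  "complex \<Rightarrow> real \<Rightarrow> (real \<Rightarrow> complex) \<Rightarrow> real \<Rightarrow> bool" where
  "displacement z T \<gamma> d \<longleftrightarrow>
     (\<exists>\<theta>. continuous_on {0..T} \<theta> \<and> (\<forall>t\<in>{0..T}. is_Arg (\<gamma> t - z) (2 * pi * \<theta> t)) \<and>
        d = \<theta> T - \<theta> 0)"

definition admissible_rotation_set :: "complex set \<Rightarrow> complex \<Rightarrow> real set" where
  "admissible_rotation_set A z =
     {r. \<exists>(d :: nat \<Rightarrow> real) (t :: nat \<Rightarrow> real).
        (\<forall>n. \<exists>\<gamma> ks. square_trajectory A (t n) \<gamma> \<and> admissible A ks \<and>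
           has_type A (t n) \<gamma> ks \<and> displacement z (t n) \<gamma> (d n)) \<and>
        filterlim t at_top sequentially \<and> (\<lambda>n. d n / t n) \<longlonglongrightarrow> r}"

end

theory Submission
  imports Defs
begin

text \<open>Unfold the square to the plane and look for trajectories whose reflection points lie close to
lattice points. Fix a large even number \<open>N\<close>. A straight path from near the origin to near
\<open>(N + 1, N)\<close> keeps the lattice points \<open>(k, k)\<close> on its left and \<open>(k + 1, k)\<close>
on its right. Folding reverses orientation in the cells of the second kind, so in the square both
kinds are passed counterclockwise, and the path, of length about \<open>\<surd>2 N\<close>, makes
\<open>N/2\<close> turns about the obstacle: this is the rate \<open>\<surd>2 / 4\<close>. The mirror path to
\<open>(N + 1, -N)\<close> makes \<open>N/2\<close> turns in the opposite sense.

After a hop that raises the first coordinate from \<open>0\<close> to \<open>N + 1\<close> the trajectory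
reflects and comes back to the column \<open>0\<close>, again raising or lowering the second coordinate by
\<open>N\<close>. Every sequence of signs \<open>\<sigma>\<close> gives such a zigzag itinerary, and once the
obstacle is small compared with \<open>1/N\<close> all of these are admissible: consecutive obstacles see
each other because \<open>N\<close> and \<open>N + 1\<close> are coprime, and the turn condition holds
because the itinerary alternates between two columns (\<open>zigzag_admissible\<close>).

A trajectory with a given itinerary is found by minimising the length of a polygon with one vertex in
each obstacle of the itinerary. Optimality of a vertex is exactly the reflection law there, and it
also keeps the edges away from the obstacles (\<open>normal_supports\<close>,
\<open>route_trajectory\<close>).

All reflections happen on the right-hand side of the folded obstacle, so the trajectory near a
reflection never meets the ray to the left of \<open>z\<close>. On such a slit plane the argument has a
continuous branch, and therefore the displacement up to any reflection is determined by the itinerary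
up to an error below one: each hop contributes \<open>\<sigma> i * N/2\<close> (\<open>hop_winding\<close>,
\<open>route_displacement\<close>).

Finally, appending one hop to the itinerary changes the minimal length by the length of
\<open>(N + 1, N)\<close> up to \<open>2 \<rho>\<close>, whatever the earlier hops were. Hence for every rate
\<open>r\<close> whose absolute value is slightly below \<open>\<surd>2 / 4\<close> the signs can be chosen one
after another, though each new hop changes the whole trajectory, so that displacement minus \<open>r\<close> times length stays bounded
(\<open>greedy_route\<close>), and \<open>r\<close> is the limit of the quotients.\<close>

section \<open>Folding the plane onto the square\<close>

text \<open>The triangle wave of period \<open>2\<close> that is the identity on \<open>[-1/2, 1/2]\<close>: one
  coordinate of the map that folds the plane onto the square along the lines
  \<open>x = n + 1/2\<close> and \<open>y = n + 1/2\<close>.\<close>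

definition tri :: "real \<Rightarrow> real" where
  "tri x = (-1) powi round x * (x - of_int (round x))"

definition fold_plane :: "complex \<Rightarrow> complex" where
  "fold_plane w = Complex (tri (Re w)) (tri (Im w))"

lemma fold_plane_sel [simp]:
  "Re (fold_plane w) = tri (Re w)" "Im (fold_plane w) = tri (Im w)"
  by (simp_all add: fold_plane_def)

lemma powi_minus_one: "(-1::real) powi p = (if even p then 1 else -1)"
  by (simp add: power_int_minus_left)

lemma tri_cell:
  assumes "\<bar>x - of_int p\<bar> \<le> 1/2"
  shows "tri x = (-1) powi p * (x - of_int p)"
proof (cases "x = of_int p + 1/2")
  case True
  have "round x = p + 1"
    unfolding round_def by (rule floor_unique) (use True in auto)
  then show ?thesis
    using True by (auto simp: tri_def powi_minus_one)
next
  case False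
  have "x < of_int p + 1/2"
    using assms False by linarith
  then have "round x = p"
    unfolding round_def by (intro floor_unique) (use assms in linarith)+
  then show ?thesis
    by (simp add: tri_def)
qed

lemma abs_minus_round_le: "\<bar>x - of_int (round x)\<bar> \<le> (1/2::real)"
  using of_int_round_abs_le[of x] by (simp add: abs_minus_commute)

lemma abs_tri: "\<bar>tri x\<bar> = \<bar>x - of_int (round x)\<bar>"
  by (simp add: tri_def abs_mult powi_minus_one)

lemma abs_tri_le: "\<bar>tri x\<bar> \<le> 1/2"
  unfolding abs_tri by (rule abs_minus_round_le)

lemma tri_id: "\<bar>x\<bar> \<le> 1/2 \<Longrightarrow> tri x = x"
  using tri_cell[of x 0] by simp

lemma tri_plus_even: "even p \<Longrightarrow> tri (of_int p + x) = tri x"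
  using tri_cell[of "of_int p + x" "p + round x"] abs_minus_round_le[of x]
  by (simp add: tri_def powi_minus_one)

lemma tri_minus: "tri (- x) = - tri x"
proof -
  have "\<bar>- x - of_int (- round x)\<bar> \<le> 1/2"
    using abs_minus_round_le[of x] by linarith
  from tri_cell[OF this] show ?thesis
    by (simp add: tri_def powi_minus_one algebra_simps)
qed

lemma tri_odd_minus:
  assumes "odd p"
  shows "tri (of_int p - x) = tri x"
proof -
  have "\<bar>of_int p - x - of_int (p - round x)\<bar> \<le> 1/2"
    using abs_minus_round_le[of x] by linarith
  from tri_cell[OF this] assms show ?thesis
    by (auto simp: tri_def powi_minus_one)
qed

lemma continuous_on_tri: "continuous_on UNIV tri"
proof -
  have "\<bar>tri x - tri y\<bar> \<le> \<bar>x - y\<bar>" for x y :: real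
  proof -
    have main: "tri y - tri x \<le> y - x \<and> tri x - tri y \<le> y - x" if "x \<le> y" for x y
    proof -
      have "round x \<le> round y"
        using that by (rule round_mono)
      then consider "round y = round x" | "round y = round x + 1" | "round y \<ge> round x + 2"
        by linarith
      then show ?thesis
      proof cases
        case 1
        then show ?thesis
          using that by (auto simp: tri_def powi_minus_one)
      next
        case 2
        then have "real_of_int (round y) = real_of_int (round x) + 1"
          by simp
        moreover have "x \<le> real_of_int (round x) + 1/2" "y \<ge> real_of_int (round y) - 1/2"
          using abs_minus_round_le[of x] abs_minus_round_le[of y] by linarith+
        ultimately show ?thesis
          using that 2 by (auto simp: tri_def powi_minus_one)
      next
        case 3
        then have "of_int (round y) \<ge> of_int (round x) + (2::real)"
          by linarith
        then show ?thesis
          using abs_minus_round_le[of x] abs_minus_round_le[of y] abs_tri_le[of x] abs_tri_le[of y]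
          by linarith
      qed
    qed
    then show ?thesis
      using main[of x y] main[of y x] by (cases "x \<le> y") (auto simp: abs_le_iff)
  qed
  then have "1-lipschitz_on UNIV tri"
    by (intro lipschitz_onI) (auto simp: dist_real_def)
  then show ?thesis
    by (rule lipschitz_on_continuous_on)
qed

lemma continuous_on_fold_plane: "continuous_on S fold_plane"
proof -
  have "continuous_on S (\<lambda>w. tri (Re w))" "continuous_on S (\<lambda>w. tri (Im w))"
    by (rule continuous_on_compose2[OF continuous_on_tri]; auto intro: continuous_intros)+
  then have "continuous_on S (\<lambda>w. complex_of_real (tri (Re w)) + \<i> * of_real (tri (Im w)))"
    by (intro continuous_intros)
  then show ?thesis
    by (rule continuous_on_eq) (auto simp: complex_eq_iff)
qed

text \<open>The linear part of \<open>to_cell\<close>.\<close>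

definition flip :: "int \<times> int \<Rightarrow> complex \<Rightarrow> complex" where
  "flip k w = Complex ((-1) powi fst k * Re w) ((-1) powi snd k * Im w)"

definition centre :: "int \<times> int \<Rightarrow> complex" where
  "centre k = Complex (of_int (fst k)) (of_int (snd k))"

lemma to_cell_flip: "to_cell k w = centre k + flip k w"
  by (simp add: to_cell_def centre_def flip_def complex_eq_iff)

lemma flip_sel [simp]:
  "Re (flip k w) = (-1) powi fst k * Re w" "Im (flip k w) = (-1) powi snd k * Im w"
  by (simp_all add: flip_def)

lemma centre_sel [simp]: "Re (centre k) = of_int (fst k)" "Im (centre k) = of_int (snd k)"
  by (simp_all add: centre_def)

lemma powi_minus_one_sq [simp]: "(-1::real) powi p * ((-1) powi p * x) = x"
  by (simp add: powi_minus_one)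

lemma flip_flip [simp]: "flip k (flip k w) = w"
  by (simp add: complex_eq_iff)

lemma linear_flip: "linear (flip k)"
  by (rule linearI) (auto simp: complex_eq_iff algebra_simps)

lemma inner_flip: "inner (flip k a) (flip k b) = inner a b"
  by (simp add: inner_complex_def powi_minus_one)

lemma inner_flip_left: "inner (flip k a) b = inner a (flip k b)"
  by (simp add: inner_complex_def powi_minus_one)

lemma norm_flip [simp]: "norm (flip k a) = norm a"
  by (simp add: norm_eq_sqrt_inner inner_flip)

lemma bij_flip: "bij (flip k)"
  by (rule o_bij[of "flip k"]) (auto simp: fun_eq_iff)

lemma obstacle_copy_flip: "obstacle_copy A k = (+) (centre k) ` flip k ` A"
  by (auto simp: obstacle_copy_def to_cell_flip)

lemma interior_obstacle_copy: "interior (obstacle_copy A k) = to_cell k ` interior A"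
proof -
  have "interior (flip k ` A) = flip k ` interior A"
    by (rule interior_bijective_linear_image[OF linear_flip bij_flip])
  then show ?thesis
    unfolding obstacle_copy_flip interior_translation by (auto simp: to_cell_flip)
qed

lemma inj_to_cell: "inj (to_cell k)"
proof (rule injI)
  fix x y assume "to_cell k x = to_cell k y"
  then have "flip k (flip k x) = flip k (flip k y)"
    by (simp add: to_cell_flip)
  then show "x = y" by simp
qed

lemma frontier_obstacle_copy:
  assumes "compact A"
  shows "frontier (obstacle_copy A k) = to_cell k ` frontier A"
proof -
  have "compact (obstacle_copy A k)"
    unfolding obstacle_copy_flip
    by (intro compact_translation compact_continuous_image assms
        linear_continuous_on linear_conv_bounded_linear[THEN iffD1] linear_flip)
  then have "closed (obstacle_copy A k)" "closed A"
    using assms by (auto intro: compact_imp_closed)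
  then show ?thesis
    unfolding frontier_def interior_obstacle_copy
    by (simp add: image_set_diff[OF inj_to_cell] obstacle_copy_def)
qed

lemma to_cell_fold_plane: "to_cell (round (Re w), round (Im w)) (fold_plane w) = w"
  by (simp add: to_cell_def fold_plane_def tri_def)

lemma fold_plane_to_cell: "fold_plane (to_cell k w) = fold_plane w"
proof -
  have "tri (of_int p + (-1) powi p * x) = tri x" for p x
    using tri_plus_even[of p x] tri_odd_minus[of p x] by (simp add: powi_minus_one)
  then show ?thesis
    by (simp add: to_cell_def complex_eq_iff)
qed

lemma fold_plane_square: "w \<in> unit_square \<Longrightarrow> fold_plane w = w"
  by (simp add: unit_square_def complex_eq_iff tri_id)

lemma fold_plane_in_square: "fold_plane w \<in> unit_square"
  unfolding unit_square_def using abs_tri_le by auto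

lemma frontier_unit_square:
  "w \<in> frontier unit_square \<longleftrightarrow> w \<in> unit_square \<and> (\<bar>Re w\<bar> = 1/2 \<or> \<bar>Im w\<bar> = 1/2)"
proof -
  have "unit_square = cbox (Complex (-1/2) (-1/2)) (Complex (1/2) (1/2))"
    by (auto simp: unit_square_def in_cbox_complex_iff abs_le_iff)
  then have "frontier unit_square = unit_square - box (Complex (-1/2) (-1/2)) (Complex (1/2) (1/2))"
    unfolding frontier_def by (metis closed_cbox closure_closed interior_cbox)
  then show ?thesis
    by (auto simp: unit_square_def in_box_complex_iff)
qed

lemma tri_germ_inside:
  assumes "\<bar>tri x\<bar> < 1/2"
  shows "\<exists>e>0. \<forall>h. \<bar>h\<bar> \<le> e \<longrightarrow> tri (x + h) = tri x + (-1) powi round x * h"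
proof (intro exI[of _ "1/2 - \<bar>tri x\<bar>"] conjI allI impI)
  fix h assume h: "\<bar>h\<bar> \<le> 1/2 - \<bar>tri x\<bar>"
  have "\<bar>x + h - of_int (round x)\<bar> \<le> 1/2"
    using h unfolding abs_tri by linarith
  from tri_cell[OF this] show "tri (x + h) = tri x + (-1) powi round x * h"
    by (simp add: tri_def algebra_simps)
qed (use assms in auto)

text \<open>On a fold line the wave has a local extremum, which makes a straight path turn back there.\<close>

lemma tri_germ_edge:
  assumes "\<bar>tri x\<bar> = 1/2" "\<bar>h\<bar> \<le> 1/2"
  shows "tri (x + h) = tri x - 2 * tri x * \<bar>h\<bar>"
proof -
  have "\<bar>x - of_int (round x)\<bar> = 1/2"
    using assms by (simp add: abs_tri)
  then obtain p :: int where p: "x = of_int p + 1/2"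
  proof (cases "x \<ge> of_int (round x)")
    case True
    then show ?thesis using that[of "round x"] \<open>\<bar>x - of_int (round x)\<bar> = 1/2\<close> by simp
  next
    case False
    then show ?thesis using that[of "round x - 1"] \<open>\<bar>x - of_int (round x)\<bar> = 1/2\<close> by simp
  qed
  have "tri x = (-1) powi p * (1/2)"
    using tri_cell[of x p] p by simp
  moreover have "tri (x + h) = (-1) powi p * (1/2 - \<bar>h\<bar>)"
  proof (cases "h \<ge> 0")
    case True
    then show ?thesis
      using tri_cell[of "x + h" "p + 1"] p assms(2) by (auto simp: powi_minus_one)
  next
    case False
    then show ?thesis
      using tri_cell[of "x + h" p] p assms(2) by (auto simp: powi_minus_one)
  qed
  ultimately show ?thesis
    by (simp add: algebra_simps)
qed

text \<open>A coordinate of a straight path, folded: the numbers \<open>b\<close> and \<open>c\<close> are its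
  velocities before and after time \<open>0\<close>. They are opposite on a fold line and equal elsewhere.\<close>

lemma tri_crossing:
  assumes "\<bar>a\<bar> \<le> 1"
  shows "\<exists>e b c. e > 0 \<and> \<bar>b\<bar> = \<bar>a\<bar> \<and> \<bar>c\<bar> = \<bar>a\<bar> \<and>
    (\<forall>h\<in>{0..e}. tri (x - h * a) = tri x - h * b \<and> tri (x + h * a) = tri x + h * c) \<and>
    c = (if \<bar>tri x\<bar> = 1/2 then - b else b)"
proof (cases "\<bar>tri x\<bar> = 1/2")
  case True
  have small: "\<bar>h * a\<bar> \<le> 1/2" if "h \<in> {0..1/2}" for h
    using mult_mono[of "\<bar>h\<bar>" "1/2" "\<bar>a\<bar>" 1] that assms by (simp add: abs_mult)
  have "\<bar>2 * tri x * \<bar>a\<bar>\<bar> = \<bar>a\<bar>"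
    using True by (simp add: abs_mult)
  moreover have "tri (x + h * a) = tri x - h * (2 * tri x * \<bar>a\<bar>)"
                "tri (x - h * a) = tri x - h * (2 * tri x * \<bar>a\<bar>)" if "h \<in> {0..1/2}" for h
    using tri_germ_edge[OF True, of "h * a"] tri_germ_edge[OF True, of "- (h * a)"] small[OF that] that
    by (auto simp: abs_mult)
  ultimately show ?thesis
    using True
    by (intro exI[of _ "1/2"] exI[of _ "2 * tri x * \<bar>a\<bar>"] exI[of _ "- (2 * tri x * \<bar>a\<bar>)"]) auto
next
  case False
  then have "\<bar>tri x\<bar> < 1/2"
    using abs_tri_le[of x] by linarith
  then obtain e where e: "e > 0"
      "\<And>h. \<bar>h\<bar> \<le> e \<Longrightarrow> tri (x + h) = tri x + (-1) powi round x * h"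
    using tri_germ_inside by blast
  have small: "\<bar>h * a\<bar> \<le> e" if "h \<in> {0..e}" for h
    using mult_mono[of "\<bar>h\<bar>" e "\<bar>a\<bar>" 1] that assms by (simp add: abs_mult)
  have "tri (x + h * a) = tri x + h * ((-1) powi round x * a)"
       "tri (x - h * a) = tri x - h * ((-1) powi round x * a)" if "h \<in> {0..e}" for h
    using e(2)[of "h * a"] e(2)[of "- (h * a)"] small[OF that] by auto
  moreover have "\<bar>(-1) powi round x * a\<bar> = \<bar>a\<bar>"
    by (simp add: abs_mult powi_minus_one)
  ultimately show ?thesis
    using e(1) False by (intro exI[of _ e] exI[of _ "(-1) powi round x * a"]) auto
qed

lemma fold_plane_crossing:
  fixes G :: "real \<Rightarrow> complex"
  assumes "norm u = 1"
  obtains u' v' where "norm u' = 1" "norm v' = 1"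
    "arrives G t u \<Longrightarrow> arrives (\<lambda>s. fold_plane (G s)) t u'"
    "departs G t u \<Longrightarrow> departs (\<lambda>s. fold_plane (G s)) t v'"
    "Re v' = (if \<bar>Re (fold_plane (G t))\<bar> = 1/2 then - Re u' else Re u')"
    "Im v' = (if \<bar>Im (fold_plane (G t))\<bar> = 1/2 then - Im u' else Im u')"
proof -
  have le: "\<bar>Re u\<bar> \<le> 1" "\<bar>Im u\<bar> \<le> 1"
    using assms abs_Re_le_cmod[of u] abs_Im_le_cmod[of u] by auto
  obtain e1 b1 c1 where "e1 > 0 \<and> \<bar>b1\<bar> = \<bar>Re u\<bar> \<and> \<bar>c1\<bar> = \<bar>Re u\<bar> \<and>
    (\<forall>h\<in>{0..e1}. tri (Re (G t) - h * Re u) = tri (Re (G t)) - h * b1 \<and>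
      tri (Re (G t) + h * Re u) = tri (Re (G t)) + h * c1) \<and>
    c1 = (if \<bar>tri (Re (G t))\<bar> = 1/2 then - b1 else b1)"
    using tri_crossing[OF le(1)] by blast
  note 1 = this[THEN conjunct1] this[THEN conjunct2, THEN conjunct1]
    this[THEN conjunct2, THEN conjunct2, THEN conjunct1]
    this[THEN conjunct2, THEN conjunct2, THEN conjunct2, THEN conjunct1, rule_format]
    this[THEN conjunct2, THEN conjunct2, THEN conjunct2, THEN conjunct2]
  obtain e2 b2 c2 where "e2 > 0 \<and> \<bar>b2\<bar> = \<bar>Im u\<bar> \<and> \<bar>c2\<bar> = \<bar>Im u\<bar> \<and>
    (\<forall>h\<in>{0..e2}. tri (Im (G t) - h * Im u) = tri (Im (G t)) - h * b2 \<and>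
      tri (Im (G t) + h * Im u) = tri (Im (G t)) + h * c2) \<and>
    c2 = (if \<bar>tri (Im (G t))\<bar> = 1/2 then - b2 else b2)"
    using tri_crossing[OF le(2)] by blast
  note 2 = this[THEN conjunct1] this[THEN conjunct2, THEN conjunct1]
    this[THEN conjunct2, THEN conjunct2, THEN conjunct1]
    this[THEN conjunct2, THEN conjunct2, THEN conjunct2, THEN conjunct1, rule_format]
    this[THEN conjunct2, THEN conjunct2, THEN conjunct2, THEN conjunct2]
  have sq: "b1\<^sup>2 = (Re u)\<^sup>2" "c1\<^sup>2 = (Re u)\<^sup>2" "b2\<^sup>2 = (Im u)\<^sup>2" "c2\<^sup>2 = (Im u)\<^sup>2"
    using 1(2,3) 2(2,3) by (metis power2_abs)+
  show ?thesis
  proof (rule that[of "Complex b1 b2" "Complex c1 c2"])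
    have "(Re u)\<^sup>2 + (Im u)\<^sup>2 = 1"
      using assms cmod_power2[of u] by simp
    then show "norm (Complex b1 b2) = 1" "norm (Complex c1 c2) = 1"
      unfolding cmod_def complex.sel sq by simp_all
    show "arrives (\<lambda>s. fold_plane (G s)) t (Complex b1 b2)" if arr: "arrives G t u"
    proof -
      obtain e where "e > 0" "\<And>h. h \<in> {0..e} \<Longrightarrow> G (t - h) = G t - h *\<^sub>R u"
        using arr unfolding arrives_def by blast
      then show ?thesis
        unfolding arrives_def using 1(1,4) 2(1,4)
        by (intro exI[of _ "min e (min e1 e2)"]) (auto simp: complex_eq_iff)
    qed
    show "departs (\<lambda>s. fold_plane (G s)) t (Complex c1 c2)" if dep: "departs G t u"
    proof -
      obtain e where "e > 0" "\<And>h. h \<in> {0..e} \<Longrightarrow> G (t + h) = G t + h *\<^sub>R u"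
        using dep unfolding departs_def by blast
      then show ?thesis
        unfolding departs_def using 1(1,4) 2(1,4)
        by (intro exI[of _ "min e (min e1 e2)"]) (auto simp: complex_eq_iff)
    qed
  qed (use 1(5) 2(5) in auto)
qed

text \<open>Reflections at the obstacle take place inside a cell, where folding is an isometry and so
  respects the reflection law.\<close>

lemma fold_plane_germ_inside:
  assumes "\<bar>tri (Re w)\<bar> < 1/2" "\<bar>tri (Im w)\<bar> < 1/2"
  shows "\<exists>e>0. \<forall>h. norm h \<le> e \<longrightarrow>
    fold_plane (w + h) = fold_plane w + flip (round (Re w), round (Im w)) h"
proof -
  obtain e1 e2 where e: "e1 > 0" "e2 > 0"
      "\<And>h. \<bar>h\<bar> \<le> e1 \<Longrightarrow> tri (Re w + h) = tri (Re w) + (-1) powi round (Re w) * h"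
      "\<And>h. \<bar>h\<bar> \<le> e2 \<Longrightarrow> tri (Im w + h) = tri (Im w) + (-1) powi round (Im w) * h"
    using tri_germ_inside[OF assms(1)] tri_germ_inside[OF assms(2)] by blast
  show ?thesis
  proof (intro exI[of _ "min e1 e2"] conjI allI impI)
    fix h :: complex assume "norm h \<le> min e1 e2"
    then have "\<bar>Re h\<bar> \<le> e1" "\<bar>Im h\<bar> \<le> e2"
      using abs_Re_le_cmod[of h] abs_Im_le_cmod[of h] by auto
    then show "fold_plane (w + h) = fold_plane w + flip (round (Re w), round (Im w)) h"
      by (simp add: complex_eq_iff e)
  qed (use e in auto)
qed

lemma obstacle_law_fold:
  assumes "obstacle_law (obstacle_copy A k) (to_cell k x) u v"
  shows "obstacle_law A x (flip k u) (flip k v)"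
proof -
  obtain n where n: "norm n = 1" "\<And>y. y \<in> obstacle_copy A k \<Longrightarrow> inner (y - to_cell k x) n \<le> 0"
      and v: "v = u - (2 * inner u n) *\<^sub>R n"
    using assms unfolding obstacle_law_def outer_unit_normal_def by blast
  have "inner (y - x) (flip k n) \<le> 0" if "y \<in> A" for y
  proof -
    have "inner (y - x) (flip k n) = inner (to_cell k y - to_cell k x) n"
      by (simp add: to_cell_flip inner_flip_left[symmetric] linear_diff[OF linear_flip])
    also have "\<dots> \<le> 0"
      using that by (intro n) (auto simp: obstacle_copy_def)
    finally show ?thesis .
  qed
  moreover have "flip k v = flip k u - (2 * inner (flip k u) (flip k n)) *\<^sub>R flip k n"
    unfolding v by (simp add: inner_flip linear_diff[OF linear_flip] linear_scale[OF linear_flip])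
  ultimately show ?thesis
    unfolding obstacle_law_def outer_unit_normal_def using n(1)
    by (intro exI[of _ "flip k n"]) auto
qed

text \<open>Folding turns reflections at the copies of the obstacle into reflections at the obstacle, and
  straight passages through a side or a vertex of a cell into reflections at the sides of the square.
  Keeping the obstacle off the sides ensures that the two kinds never occur at the same time.\<close>

lemma fold_plane_trajectory:
  assumes "compact A" and A: "\<And>w. w \<in> A \<Longrightarrow> \<bar>Re w\<bar> < 1/2 \<and> \<bar>Im w\<bar> < 1/2"
    and "plane_trajectory A T G"
  shows "square_trajectory A T (\<lambda>t. fold_plane (G t))"
    and "unfolding_of A T (\<lambda>t. fold_plane (G t)) G"
proof -
  let ?g = "\<lambda>t. fold_plane (G t)"
  note tr = assms(3)[unfolded plane_trajectory_def trajectory_def]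
  have fr_sub: "frontier A \<subseteq> A"
    using assms(1) by (simp add: compact_imp_closed frontier_subset_closed)
  have "A \<subseteq> unit_square"
    using A by (force simp: unit_square_def)
  show "unfolding_of A T ?g G"
    unfolding unfolding_of_def using assms(3) to_cell_fold_plane by metis
  have "?g t \<in> unit_square - interior A" if "t \<in> {0..T}" for t
  proof -
    have "G t \<notin> interior (obstacle_copy A k)" for k
      using tr that by blast
    then have "fold_plane (G t) \<notin> interior A"
      unfolding interior_obstacle_copy by (metis imageI to_cell_fold_plane)
    then show ?thesis
      using fold_plane_in_square by simp
  qed
  moreover have "\<exists>v. norm v = 1 \<and> departs ?g 0 v"
    using tr fold_plane_crossing[of _ G 0] by metis
  moreover have "\<exists>u. norm u = 1 \<and> arrives ?g T u"
    using tr fold_plane_crossing[of _ G T] by metis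
  moreover have "\<exists>u v. norm u = 1 \<and> norm v = 1 \<and> arrives ?g t u \<and> departs ?g t v \<and>
      square_law A (?g t) u v" if t: "t \<in> {0<..<T}" for t
  proof -
    obtain u v where uv: "norm u = 1" "norm v = 1" "arrives G t u" "departs G t v"
        and law: "plane_law A (G t) u v"
      using tr t by blast
    show ?thesis
    proof (cases "?g t \<in> frontier A")
      case True
      define k where "k = (round (Re (G t)), round (Im (G t)))"
      have k: "G t = to_cell k (?g t)"
        unfolding k_def by (simp add: to_cell_fold_plane)
      have inside: "\<bar>Re (?g t)\<bar> < 1/2" "\<bar>Im (?g t)\<bar> < 1/2"
        using True fr_sub A by blast+
      then obtain e where e: "e > 0" "\<And>h. norm h \<le> e \<Longrightarrow> fold_plane (G t + h) = ?g t + flip k h"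
        using fold_plane_germ_inside[of "G t"] unfolding k_def by auto
      have "departs ?g t (flip k v)"
      proof -
        obtain e' where e': "e' > 0" "\<And>h. h \<in> {0..e'} \<Longrightarrow> G (t + h) = G t + h *\<^sub>R v"
          using uv(4) unfolding departs_def by blast
        show ?thesis
          unfolding departs_def using e e' uv(2)
          by (intro exI[of _ "min e e'"]) (auto simp: linear_scale[OF linear_flip])
      qed
      moreover have "arrives ?g t (flip k u)"
      proof -
        obtain e' where e': "e' > 0" "\<And>h. h \<in> {0..e'} \<Longrightarrow> G (t - h) = G t - h *\<^sub>R u"
          using uv(3) unfolding arrives_def by blast
        show ?thesis
          unfolding arrives_def using e(1) e' uv(1) e(2)[of "- (_ *\<^sub>R u)"]
          by (intro exI[of _ "min e e'"])
             (auto simp: linear_scale[OF linear_flip] linear_neg[OF linear_flip])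
      qed
      moreover have "square_law A (?g t) (flip k u) (flip k v)"
      proof -
        have "G t \<in> frontier (obstacle_copy A k)"
          unfolding frontier_obstacle_copy[OF assms(1)] using True k by blast
        then have "obstacle_law (obstacle_copy A k) (to_cell k (?g t)) u v"
          using law k unfolding plane_law_def by metis
        then show ?thesis
          using True inside obstacle_law_fold by (auto simp: square_law_def frontier_unit_square)
      qed
      ultimately show ?thesis
        using uv by (intro exI[of _ "flip k u"] exI[of _ "flip k v"]) auto
    next
      case False
      have "G t \<notin> frontier (obstacle_copy A k)" for k
      proof
        assume "G t \<in> frontier (obstacle_copy A k)"
        then obtain w where "w \<in> frontier A" "G t = to_cell k w"
          unfolding frontier_obstacle_copy[OF assms(1)] by blast
        then show False
          using False fr_sub \<open>A \<subseteq> unit_square\<close> by (simp add: fold_plane_to_cell fold_plane_square subset_iff)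
      qed
      then have "v = u"
        using law by (simp add: plane_law_def)
      show ?thesis
      proof (rule fold_plane_crossing[OF uv(1), of G t])
        fix u' v'
        assume c: "norm u' = 1" "norm v' = 1"
          "arrives G t u \<Longrightarrow> arrives ?g t u'" "departs G t u \<Longrightarrow> departs ?g t v'"
          "Re v' = (if \<bar>Re (?g t)\<bar> = 1/2 then - Re u' else Re u')"
          "Im v' = (if \<bar>Im (?g t)\<bar> = 1/2 then - Im u' else Im u')"
        have "square_law A (?g t) u' v'"
          unfolding square_law_def side_law_def frontier_unit_square
          using False c(5,6) fold_plane_in_square[of "G t"] by (auto simp: complex_eq_iff)
        then show ?thesis
          using c(1-4) uv(3,4) \<open>v = u\<close> by blast
      qed
    qed
  qed
  moreover have "0 < T"
    using tr by blast
  ultimately show "square_trajectory A T ?g"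
    unfolding square_trajectory_def trajectory_def by blast
qed

section \<open>Polygonal trajectories\<close>

definition vertex_time :: "(nat \<Rightarrow> complex) \<Rightarrow> nat \<Rightarrow> real" where
  "vertex_time x n = (\<Sum>i<n. norm (x (Suc i) - x i))"

text \<open>The polygon with vertices \<open>x 0, \<dots>, x s\<close>, run through at unit speed. Edge
  \<open>i\<close> contributes its direction times the part of the edge traversed by time \<open>t\<close>;
  in this form continuity is immediate.\<close>

definition polyline :: "(nat \<Rightarrow> complex) \<Rightarrow> nat \<Rightarrow> real \<Rightarrow> complex" where
  "polyline x s t = x 0 + (\<Sum>i<s. (min (max t (vertex_time x i)) (vertex_time x (Suc i)) - vertex_time x i)
      *\<^sub>R sgn (x (Suc i) - x i))"

lemma vertex_time_0 [simp]: "vertex_time x 0 = 0"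
  by (simp add: vertex_time_def)

lemma vertex_time_Suc: "vertex_time x (Suc n) = vertex_time x n + norm (x (Suc n) - x n)"
  by (simp add: vertex_time_def)

lemma mono_vertex_time: "m \<le> n \<Longrightarrow> vertex_time x m \<le> vertex_time x n"
  unfolding vertex_time_def by (intro sum_mono2) auto

lemma norm_scaleR_sgn: "norm w *\<^sub>R sgn w = (w :: complex)"
  by (cases "w = 0") (simp_all add: sgn_div_norm)

lemma polyline_on_edge:
  assumes "i < s" "vertex_time x i \<le> t" "t \<le> vertex_time x (Suc i)"
  shows "polyline x s t = x i + (t - vertex_time x i) *\<^sub>R sgn (x (Suc i) - x i)"
proof -
  define f where "f j = (min (max t (vertex_time x j)) (vertex_time x (Suc j)) - vertex_time x j)
      *\<^sub>R sgn (x (Suc j) - x j)" for j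
  have before: "f j = x (Suc j) - x j" if "j < i" for j
  proof -
    have "vertex_time x (Suc j) \<le> t"
      using mono_vertex_time[of "Suc j" i x] that assms(2) by simp
    then show ?thesis
      using mono_vertex_time[of j "Suc j" x]
      by (simp add: f_def vertex_time_Suc norm_scaleR_sgn)
  qed
  have after: "f j = 0" if "i < j" for j
  proof -
    have "t \<le> vertex_time x j"
      using mono_vertex_time[of "Suc i" j x] that assms(3) by simp
    then show ?thesis
      by (simp add: f_def vertex_time_Suc)
  qed
  have "(\<Sum>j<s. f j) = (\<Sum>j<Suc i. f j)"
    using assms(1) after by (intro sum.mono_neutral_right) (auto simp: less_Suc_eq_le not_le)
  also have "\<dots> = (\<Sum>j<i. x (Suc j) - x j) + f i"
    using before by simp
  also have "(\<Sum>j<i. x (Suc j) - x j) = x i - x 0"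
    by (rule sum_lessThan_telescope)
  also have "f i = (t - vertex_time x i) *\<^sub>R sgn (x (Suc i) - x i)"
    using assms by (simp add: f_def)
  finally show ?thesis
    by (simp add: polyline_def f_def)
qed

lemma continuous_on_polyline: "continuous_on S (polyline x s)"
  unfolding polyline_def by (intro continuous_intros)

lemma polyline_at_vertex:
  assumes "i \<le> s" "0 < s"
  shows "polyline x s (vertex_time x i) = x i"
proof (cases "i < s")
  case True
  then show ?thesis
    using polyline_on_edge[of i s x "vertex_time x i"] by (simp add: vertex_time_Suc)
next
  case False
  with assms obtain j where j: "s = Suc j" "i = Suc j"
    by (metis Suc_pred le_neq_implies_less)
  then show ?thesis
    using polyline_on_edge[of j s x "vertex_time x i"]
    by (simp add: vertex_time_Suc norm_scaleR_sgn)
qed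

lemma departs_polyline:
  assumes "i < s" "vertex_time x i \<le> t" "t < vertex_time x (Suc i)"
  shows "departs (polyline x s) t (sgn (x (Suc i) - x i))"
  unfolding departs_def
proof (intro exI[of _ "vertex_time x (Suc i) - t"] conjI ballI)
  fix h assume "h \<in> {0..vertex_time x (Suc i) - t}"
  then show "polyline x s (t + h) = polyline x s t + h *\<^sub>R sgn (x (Suc i) - x i)"
    using assms by (simp add: polyline_on_edge[of i] algebra_simps)
qed (use assms in auto)

lemma arrives_polyline:
  assumes "i < s" "vertex_time x i < t" "t \<le> vertex_time x (Suc i)"
  shows "arrives (polyline x s) t (sgn (x (Suc i) - x i))"
  unfolding arrives_def
proof (intro exI[of _ "t - vertex_time x i"] conjI ballI)
  fix h assume "h \<in> {0..t - vertex_time x i}"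
  then show "polyline x s (t - h) = polyline x s t - h *\<^sub>R sgn (x (Suc i) - x i)"
    using assms by (simp add: polyline_on_edge[of i] algebra_simps)
qed (use assms in auto)

lemma arrives_unique:
  assumes "arrives G t u" "arrives G t v"
  shows "u = v"
proof -
  obtain e d where "e > 0" "\<forall>h\<in>{0..e}. G (t - h) = G t - h *\<^sub>R u"
      and "d > 0" "\<forall>h\<in>{0..d}. G (t - h) = G t - h *\<^sub>R v"
    using assms unfolding arrives_def by blast
  moreover define h where "h = min e d"
  ultimately have "h \<in> {0..e}" "h \<in> {0..d}" "h \<noteq> 0"
      and *: "\<forall>h\<in>{0..e}. G (t - h) = G t - h *\<^sub>R u" "\<forall>h\<in>{0..d}. G (t - h) = G t - h *\<^sub>R v"
    by auto
  have "G t - h *\<^sub>R u = G t - h *\<^sub>R v"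
    using *(1)[rule_format, OF \<open>h \<in> {0..e}\<close>] *(2)[rule_format, OF \<open>h \<in> {0..d}\<close>] by metis
  then show ?thesis using \<open>h \<noteq> 0\<close> by simp
qed

lemma departs_unique:
  assumes "departs G t u" "departs G t v"
  shows "u = v"
proof -
  obtain e d where "e > 0" "\<forall>h\<in>{0..e}. G (t + h) = G t + h *\<^sub>R u"
      and "d > 0" "\<forall>h\<in>{0..d}. G (t + h) = G t + h *\<^sub>R v"
    using assms unfolding departs_def by blast
  moreover define h where "h = min e d"
  ultimately have "h \<in> {0..e}" "h \<in> {0..d}" "h \<noteq> 0"
      and *: "\<forall>h\<in>{0..e}. G (t + h) = G t + h *\<^sub>R u" "\<forall>h\<in>{0..d}. G (t + h) = G t + h *\<^sub>R v"
    by auto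
  have "G t + h *\<^sub>R u = G t + h *\<^sub>R v"
    using *(1)[rule_format, OF \<open>h \<in> {0..e}\<close>] *(2)[rule_format, OF \<open>h \<in> {0..d}\<close>] by metis
  then show ?thesis using \<open>h \<noteq> 0\<close> by simp
qed

lemma vertex_time_cases:
  assumes "0 \<le> t" "t \<le> vertex_time x s" "0 < s"
  obtains i where "i \<le> s" "t = vertex_time x i"
    | i where "i < s" "vertex_time x i < t" "t < vertex_time x (Suc i)"
proof -
  define i where "i = (LEAST i. t \<le> vertex_time x i)"
  have i: "t \<le> vertex_time x i" "i \<le> s"
    unfolding i_def using assms(2) by (auto intro: LeastI Least_le)
  show ?thesis
  proof (cases i)
    case 0
    then show ?thesis
      using that(1)[of 0] i assms(1) by simp
  next
    case (Suc j)
    then have "vertex_time x j < t"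
      using not_less_Least[of j "\<lambda>i. t \<le> vertex_time x i"] unfolding i_def by simp
    then show ?thesis
      using that(1)[of i] that(2)[of j] i Suc by (cases "t = vertex_time x i") auto
  qed
qed

text \<open>What has to be checked for a polygon to be a trajectory in the plane: the edges avoid the
  obstacles, and the reflection law holds, with a genuine change of direction, at the inner vertices.\<close>

lemma polyline_trajectory:
  assumes "0 < s"
    and distinct: "\<And>i. i < s \<Longrightarrow> x (Suc i) \<noteq> x i"
    and vertices: "\<And>i k. i \<le> s \<Longrightarrow> x i \<notin> interior (obstacle_copy A k)"
    and edges: "\<And>i t k. i < s \<Longrightarrow> 0 < t \<Longrightarrow> t < norm (x (Suc i) - x i) \<Longrightarrow>
        x i + t *\<^sub>R sgn (x (Suc i) - x i) \<notin> obstacle_copy A k"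
    and closed: "\<And>k. closed (obstacle_copy A k)"
    and law: "\<And>i. Suc i < s \<Longrightarrow>
        plane_law A (x (Suc i)) (sgn (x (Suc i) - x i)) (sgn (x (Suc (Suc i)) - x (Suc i)))"
    and turns: "\<And>i. Suc i < s \<Longrightarrow> sgn (x (Suc i) - x i) \<noteq> sgn (x (Suc (Suc i)) - x (Suc i))"
  shows "plane_trajectory A (vertex_time x s) (polyline x s)"
    and "{t \<in> {0<..<vertex_time x s}. reflects_at (polyline x s) t} = vertex_time x ` {0<..<s}"
    and "strict_mono_on {0..s} (vertex_time x)"
proof -
  let ?G = "polyline x s" and ?T = "vertex_time x s"
  have step: "vertex_time x i < vertex_time x (Suc i)" if "i < s" for i
    using distinct[OF that] by (simp add: vertex_time_Suc)
  have strict: "vertex_time x i < vertex_time x j" if "i < j" "j \<le> s" for i j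
    using step[of i] mono_vertex_time[of "Suc i" j x] that by simp
  then show "strict_mono_on {0..s} (vertex_time x)"
    by (auto simp: strict_mono_on_def)
  have unit: "norm (sgn (x (Suc i) - x i)) = 1" if "i < s" for i
    using distinct[OF that] by (simp add: norm_sgn)
  have inner_point: "?G t \<notin> obstacle_copy A k"
    if "i < s" "vertex_time x i < t" "t < vertex_time x (Suc i)" for i t k
    using edges[of i "t - vertex_time x i" k] that
    by (simp add: polyline_on_edge[of i] vertex_time_Suc)
  have edge_vel: "arrives ?G t (sgn (x (Suc i) - x i))" "departs ?G t (sgn (x (Suc i) - x i))"
    if "i < s" "vertex_time x i < t" "t < vertex_time x (Suc i)" for i t
    using that arrives_polyline departs_polyline by auto
  have vertex_vel: "arrives ?G (vertex_time x (Suc i)) (sgn (x (Suc i) - x i))"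
      "departs ?G (vertex_time x (Suc i)) (sgn (x (Suc (Suc i)) - x (Suc i)))"
    if "Suc i < s" for i
    using that step[of i] step[of "Suc i"] arrives_polyline[of i] departs_polyline[of "Suc i"] by auto
  have cases: "(\<exists>i. Suc i < s \<and> t = vertex_time x (Suc i)) \<or>
      (\<exists>i<s. vertex_time x i < t \<and> t < vertex_time x (Suc i))" if "t \<in> {0<..<?T}" for t
  proof -
    have "0 \<le> t" "t \<le> ?T" using that by auto
    then show ?thesis
    proof (rule vertex_time_cases[OF _ _ assms(1)])
      fix i assume "i \<le> s" "t = vertex_time x i"
      moreover from this have "i \<noteq> 0" "i \<noteq> s"
        using that by (auto intro: gr0I)
      ultimately show ?thesis
        by (intro disjI1 exI[of _ "i - 1"]) auto
    qed blast
  qed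
  show "plane_trajectory A ?T ?G"
    unfolding plane_trajectory_def trajectory_def
  proof (intro conjI ballI)
    show "0 < ?T" using strict[OF assms(1)] by simp
    show "?G t \<in> - (\<Union>k. interior (obstacle_copy A k))" if t: "t \<in> {0..?T}" for t
    proof -
      have "0 \<le> t" "t \<le> ?T" using t by auto
      then have "?G t \<notin> interior (obstacle_copy A k)" for k
      proof (rule vertex_time_cases[OF _ _ assms(1)])
        fix i assume "i \<le> s" "t = vertex_time x i"
        then show ?thesis using vertices polyline_at_vertex assms(1) by metis
      next
        fix i assume "i < s" "vertex_time x i < t" "t < vertex_time x (Suc i)"
        then show ?thesis using inner_point interior_subset by blast
      qed
      then show ?thesis by blast
    qed
    show "\<exists>v. norm v = 1 \<and> departs ?G 0 v"
      using departs_polyline[of 0 s x 0] unit[of 0] step[of 0] assms(1) by auto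
    obtain j where j: "s = Suc j" using assms(1) gr0_implies_Suc by blast
    then show "\<exists>u. norm u = 1 \<and> arrives ?G ?T u"
      using arrives_polyline[of j s x ?T] unit[of j] step[of j] by auto
    fix t assume "t \<in> {0<..<?T}"
    from cases[OF this] show "\<exists>u v. norm u = 1 \<and> norm v = 1 \<and> arrives ?G t u \<and>
        departs ?G t v \<and> plane_law A (?G t) u v"
    proof (elim disjE exE conjE)
      fix i assume "Suc i < s" "t = vertex_time x (Suc i)"
      then show ?thesis
        using vertex_vel law unit[of i] unit[of "Suc i"] polyline_at_vertex[of "Suc i" s x] by force
    next
      fix i assume i: "i < s" "vertex_time x i < t" "t < vertex_time x (Suc i)"
      then have "?G t \<notin> frontier (obstacle_copy A k)" for k
        using inner_point closed frontier_subset_closed by blast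
      then have "plane_law A (?G t) u u" for u
        by (simp add: plane_law_def)
      then show ?thesis
        using edge_vel[OF i] unit[OF i(1)] by blast
    qed
  qed
  show "{t \<in> {0<..<?T}. reflects_at ?G t} = vertex_time x ` {0<..<s}"
  proof (intro equalityI subsetI)
    fix t assume t: "t \<in> {t \<in> {0<..<?T}. reflects_at ?G t}"
    then have "t \<in> {0<..<?T}" by simp
    from cases[OF this] show "t \<in> vertex_time x ` {0<..<s}"
    proof (elim disjE exE conjE)
      fix i assume i: "i < s" "vertex_time x i < t" "t < vertex_time x (Suc i)"
      then show ?thesis
        using t edge_vel[OF i] arrives_unique departs_unique unfolding reflects_at_def by blast
    qed auto
  next
    fix t assume "t \<in> vertex_time x ` {0<..<s}"
    then obtain j where j: "j \<in> {0<..<s}" "t = vertex_time x j"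
      by blast
    then obtain i where "Suc i < s" "t = vertex_time x (Suc i)"
      by (cases j) auto
    then show "t \<in> {t \<in> {0<..<?T}. reflects_at ?G t}"
      using vertex_vel[of i] turns[of i] strict[of 0 "Suc i"] strict[of "Suc i" s]
      unfolding reflects_at_def by auto
  qed
qed

section \<open>Shortest routes between obstacles\<close>

text \<open>The derivative of the distance together with an explicit quadratic error, from
  \<open>sqrt (1 + x) \<le> 1 + x / 2\<close>.\<close>

lemma norm_diff_first_order:
  fixes h d :: complex
  assumes "h \<noteq> 0"
  shows "norm (h - d) \<le> norm h - inner (sgn h) d + (norm d)\<^sup>2 / (2 * norm h)"
proof (rule power2_le_imp_le)
  define x where "x = - inner (sgn h) d + (norm d)\<^sup>2 / (2 * norm h)"
  have pos: "norm h > 0" using assms by simp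
  have "norm h * inner (sgn h) d = inner h d"
    using pos by (simp add: sgn_div_norm)
  then have "2 * norm h * x = (norm d)\<^sup>2 - 2 * inner h d"
    using pos by (simp add: x_def field_simps)
  then have "(norm (h - d))\<^sup>2 = (norm h)\<^sup>2 + 2 * norm h * x"
    unfolding power2_norm_eq_inner by (simp add: inner_diff inner_commute algebra_simps)
  also have "\<dots> \<le> (norm h + x)\<^sup>2"
    by (simp add: power2_sum)
  finally show "(norm (h - d))\<^sup>2 \<le> (norm h - inner (sgn h) d + (norm d)\<^sup>2 / (2 * norm h))\<^sup>2"
    by (simp add: x_def algebra_simps)
  have "inner (sgn h) d \<le> norm d"
    using norm_cauchy_schwarz[of "sgn h" d] assms by (simp add: norm_sgn)
  then have "norm h + x \<ge> norm h - norm d + (norm d)\<^sup>2 / (2 * norm h)"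
    by (simp add: x_def)
  also have "norm h - norm d + (norm d)\<^sup>2 / (2 * norm h)
      = ((norm h)\<^sup>2 + (norm h - norm d)\<^sup>2) / (2 * norm h)"
    using pos by (simp add: field_simps power2_eq_square)
  also have "\<dots> \<ge> 0"
    by simp
  finally show "0 \<le> norm h - inner (sgn h) d + (norm d)\<^sup>2 / (2 * norm h)"
    by (simp add: x_def)
qed

text \<open>The first-order condition at a point \<open>a\<close> of \<open>A\<close> that minimises a weighted sum
  of distances to \<open>p\<close> and \<open>q\<close>: moving from \<open>a\<close> towards another point of
  \<open>A\<close> cannot shorten the sum. Weights zero and one cover the end points of a route, which have
  one neighbour only.\<close>

lemma shortest_detour_support:
  fixes a p q :: complex
  assumes "convex A" "a \<in> A" "y \<in> A" "p \<noteq> a" "q \<noteq> a" "c \<ge> 0" "d \<ge> 0"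
    and min: "\<And>x. x \<in> A \<Longrightarrow> c * norm (p - a) + d * norm (q - a) \<le> c * norm (p - x) + d * norm (q - x)"
  shows "inner (y - a) (c *\<^sub>R sgn (p - a) + d *\<^sub>R sgn (q - a)) \<le> 0" (is "?I \<le> 0")
proof (rule ccontr)
  define K where "K = c * ((norm (y - a))\<^sup>2 / (2 * norm (p - a))) + d * ((norm (y - a))\<^sup>2 / (2 * norm (q - a)))"
  assume "\<not> ?I \<le> 0"
  then have I: "?I > 0" by simp
  have "K \<ge> 0"
    using assms by (simp add: K_def)
  \<comment> \<open>a step so short that the quadratic error is less than half of the gain\<close>
  define t where "t = min 1 (?I / (2 * (K + 1)))"
  have t: "0 < t" "t \<le> 1"
    using I \<open>K \<ge> 0\<close> by (auto simp: t_def)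
  have "a + t *\<^sub>R (y - a) \<in> A"
    using convexD_alt[OF assms(1,2,3), of t] t by (simp add: algebra_simps)
  from min[OF this]
  have "c * norm (p - a) + d * norm (q - a) \<le>
      c * norm ((p - a) - t *\<^sub>R (y - a)) + d * norm ((q - a) - t *\<^sub>R (y - a))"
    by (simp add: algebra_simps)
  also have "\<dots> \<le> c * (norm (p - a) - inner (sgn (p - a)) (t *\<^sub>R (y - a))
          + (norm (t *\<^sub>R (y - a)))\<^sup>2 / (2 * norm (p - a)))
      + d * (norm (q - a) - inner (sgn (q - a)) (t *\<^sub>R (y - a))
          + (norm (t *\<^sub>R (y - a)))\<^sup>2 / (2 * norm (q - a)))"
    using assms by (intro add_mono mult_left_mono norm_diff_first_order) auto
  also have "\<dots> = c * norm (p - a) + d * norm (q - a) - t * ?I + t\<^sup>2 * K"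
    unfolding norm_scaleR power_mult_distrib power2_abs K_def
    by (simp add: inner_add_right inner_commute algebra_simps)
  finally have "t * ?I \<le> t * (t * K)"
    by (simp add: power2_eq_square algebra_simps)
  then have "?I \<le> t * K"
    using t by simp
  also have "\<dots> \<le> ?I / (2 * (K + 1)) * K"
    using \<open>K \<ge> 0\<close> by (intro mult_right_mono) (auto simp: t_def)
  also have "\<dots> = ?I * (K / (2 * (K + 1)))"
    by simp
  also have "\<dots> < ?I * 1"
    using \<open>K \<ge> 0\<close> I by (intro mult_strict_left_mono) (auto simp: field_simps)
  finally show False by simp
qed

lemma support_interior_neg:
  fixes a \<nu> :: complex
  assumes "\<And>y. y \<in> A \<Longrightarrow> inner (y - a) \<nu> \<le> 0" "\<nu> \<noteq> 0" "z \<in> interior A"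
  shows "inner (z - a) \<nu> < 0"
proof -
  obtain e where e: "e > 0" "cball z e \<subseteq> A"
    using assms(3) mem_interior_cball by blast
  have "z + (e / norm \<nu>) *\<^sub>R \<nu> \<in> A"
    using e assms(2) by (intro subsetD[OF e(2)]) (simp add: dist_norm)
  from assms(1)[OF this] have "inner (z - a) \<nu> + (e / norm \<nu>) * inner \<nu> \<nu> \<le> 0"
    by (simp add: inner_diff_left inner_add_left)
  moreover have "(e / norm \<nu>) * inner \<nu> \<nu> > 0"
    using e(1) assms(2) by simp
  ultimately show ?thesis by linarith
qed

lemma obstacle_law_unfold:
  assumes "obstacle_law A x u v"
  shows "obstacle_law (obstacle_copy A k) (to_cell k x) (flip k u) (flip k v)"
proof -
  obtain n where n: "norm n = 1" "\<And>y. y \<in> A \<Longrightarrow> inner (y - x) n \<le> 0"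
      and v: "v = u - (2 * inner u n) *\<^sub>R n"
    using assms unfolding obstacle_law_def outer_unit_normal_def by blast
  have "inner (y - to_cell k x) (flip k n) \<le> 0" if "y \<in> obstacle_copy A k" for y
    using that n(2) by (auto simp: obstacle_copy_def to_cell_flip inner_flip
        linear_diff[OF linear_flip, symmetric])
  moreover have "flip k v = flip k u - (2 * inner (flip k u) (flip k n)) *\<^sub>R flip k n"
    unfolding v by (simp add: inner_flip linear_diff[OF linear_flip] linear_scale[OF linear_flip])
  ultimately show ?thesis
    unfolding obstacle_law_def outer_unit_normal_def using n(1)
    by (intro exI[of _ "flip k n"]) auto
qed

text \<open>The reflection that takes a unit vector \<open>u\<close> to \<open>v\<close> has normal \<open>v - u\<close>, so the
  reflection law only requires the change of velocity to be normal to the boundary.\<close>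

lemma reflection_in_bisector:
  fixes u v :: complex
  assumes "norm u = 1" "norm v = 1" "u \<noteq> v"
  shows "v = u - (2 * inner u (sgn (v - u))) *\<^sub>R sgn (v - u)"
proof -
  have "(norm (v - u))\<^sup>2 = - 2 * inner u (v - u)"
    using assms unfolding norm_eq_1 power2_norm_eq_inner by (simp add: inner_diff inner_commute)
  moreover define m where "m = norm (v - u)"
  ultimately have "2 * inner u (v - u) = - (m * m)" "m \<noteq> 0"
    using assms(3) by (simp_all add: power2_eq_square)
  moreover have "sgn (v - u) = inverse m *\<^sub>R (v - u)"
    by (simp add: sgn_div_norm m_def)
  ultimately have "(2 * inner u (sgn (v - u))) *\<^sub>R sgn (v - u) =
      ((2 * inner u (v - u)) * inverse m * inverse m) *\<^sub>R (v - u)"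
    by (simp add: ac_simps)
  also have "\<dots> = (- (m * m) * inverse m * inverse m) *\<^sub>R (v - u)"
    using \<open>2 * inner u (v - u) = - (m * m)\<close> by simp
  also have "- (m * m) * inverse m * inverse m = -1"
    using \<open>m \<noteq> 0\<close> by (simp add: field_simps)
  also have "-1 *\<^sub>R (v - u) = - (v - u)"
    by simp
  finally have "(2 * inner u (sgn (v - u))) *\<^sub>R sgn (v - u) = - (v - u)" .
  then show ?thesis by simp
qed

lemma right_half_plane_not_opposite:
  fixes u v :: complex
  assumes "norm u = 1" "norm v = 1" "0 < Re u" "0 < Re v"
  shows "0 < 1 + inner u v"
proof -
  have "0 < (norm (u + v))\<^sup>2"
    using assms(3,4) by (auto simp: complex_eq_iff)
  also have "\<dots> = 2 * (1 + inner u v)"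
    using assms(1,2) unfolding norm_eq_1 power2_norm_eq_inner by (simp add: inner_add inner_commute)
  finally show ?thesis by simp
qed

text \<open>The obstacle lies in a disk that is tiny compared with \<open>1/N\<close>, while hops have length
  about \<open>\<surd>2 N\<close>. Evenness of \<open>N\<close> is what makes a hop end with the same orientation
  in the second coordinate, and with the opposite one in the first.\<close>

locale tiny_obstacle =
  fixes A :: "complex set" and N :: nat and \<rho> :: real
  assumes compact_A: "compact A" and convex_A: "convex A" and interior_A: "interior A \<noteq> {}"
    and A_small: "A \<subseteq> cball 0 \<rho>" and even_N: "even N" and N_pos: "0 < N"
    and \<rho>_small: "16 * (real N + 2) * \<rho> < 1"
begin

text \<open>The vector of a hop in direction \<open>(N + 1, s * N)\<close>, seen from the cell where it starts:
  it leads from \<open>a\<close> to the point that folds to \<open>b\<close>. Its end lies in a cell that is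
  mirrored in the first coordinate, whence \<open>- cnj b\<close> instead of \<open>+ b\<close>.\<close>

definition hop :: "int \<Rightarrow> complex \<Rightarrow> complex \<Rightarrow> complex" where
  "hop s a b = Complex (real N + 1) (of_int s * real N) - a - cnj b"

definition route_length :: "(nat \<Rightarrow> int) \<Rightarrow> nat \<Rightarrow> (nat \<Rightarrow> complex) \<Rightarrow> real" where
  "route_length \<sigma> n \<xi> = (\<Sum>i<n. norm (hop (\<sigma> i) (\<xi> i) (\<xi> (Suc i))))"

definition shortest :: "(nat \<Rightarrow> int) \<Rightarrow> nat \<Rightarrow> (nat \<Rightarrow> complex) \<Rightarrow> bool" where
  "shortest \<sigma> n \<xi> \<longleftrightarrow> range \<xi> \<subseteq> A \<and>
     (\<forall>\<eta>. range \<eta> \<subseteq> A \<longrightarrow> route_length \<sigma> n \<xi> \<le> route_length \<sigma> n \<eta>)"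

lemma A_norm: "a \<in> A \<Longrightarrow> norm a \<le> \<rho>"
  using A_small by auto

lemma A_nonempty: "A \<noteq> {}"
  using interior_A interior_subset by blast

lemma \<rho>_nonneg: "0 \<le> \<rho>"
  using A_nonempty A_norm norm_ge_zero order_trans by blast

lemma \<rho>_bound: "48 * \<rho> < 1"
proof -
  have "48 * \<rho> \<le> 16 * (real N + 2) * \<rho>"
    using N_pos \<rho>_nonneg by (intro mult_right_mono) auto
  then show ?thesis
    using \<rho>_small by simp
qed

lemma A_coords:
  assumes "a \<in> A"
  shows "\<bar>Re a\<bar> \<le> \<rho>" "\<bar>Im a\<bar> \<le> \<rho>"
  using A_norm[OF assms] abs_Re_le_cmod[of a] abs_Im_le_cmod[of a] by auto

lemma Re_hop_pos: "a \<in> A \<Longrightarrow> b \<in> A \<Longrightarrow> 0 < Re (hop s a b)"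
  using A_coords[of a] A_coords[of b] \<rho>_bound by (auto simp: hop_def)

lemma norm_hop_bounds:
  assumes "a \<in> A" "b \<in> A" "\<bar>s\<bar> = 1"
  shows "\<bar>norm (hop s a b) - sqrt (2 * (real N)\<^sup>2 + 2 * real N + 1)\<bar> \<le> 2 * \<rho>"
proof -
  let ?c = "Complex (real N + 1) (of_int s * real N)"
  have "(of_int s :: real)\<^sup>2 = 1"
    using assms(3) by (metis of_int_1 of_int_abs one_power2 power2_abs)
  then have "norm ?c = sqrt (2 * (real N)\<^sup>2 + 2 * real N + 1)"
    by (simp add: cmod_def power_mult_distrib) (simp add: power2_eq_square algebra_simps)
  moreover have "\<bar>norm (hop s a b) - norm ?c\<bar> \<le> norm (hop s a b - ?c)"
    by (rule norm_triangle_ineq3)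
  moreover have "norm (hop s a b - ?c) \<le> norm a + norm b"
    using norm_triangle_ineq[of "- a" "- cnj b"] by (simp add: hop_def)
  ultimately show ?thesis
    using A_norm[OF assms(1)] A_norm[OF assms(2)] by linarith
qed

text \<open>The product of countably many copies of \<open>A\<close> is compact.\<close>

lemma exists_shortest: "\<exists>\<xi>. shortest \<sigma> n \<xi>"
proof -
  have "compactin (product_topology (\<lambda>i::nat. euclidean) UNIV) (PiE UNIV (\<lambda>i::nat. A))"
    using compact_A by (simp add: compactin_PiE)
  then have "compact (PiE UNIV (\<lambda>i::nat. A))"
    by (simp add: euclidean_product_topology)
  moreover have "continuous_on (PiE UNIV (\<lambda>i::nat. A)) (route_length \<sigma> n)"
    unfolding route_length_def hop_def
    by (intro continuous_intros continuous_on_subset[OF continuous_on_product_coordinates]) auto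
  moreover have "PiE UNIV (\<lambda>i::nat. A) \<noteq> {}"
    using A_nonempty by (simp add: PiE_eq_empty_iff)
  ultimately obtain \<xi> where "\<xi> \<in> PiE UNIV (\<lambda>i::nat. A)"
      "\<forall>\<eta>\<in>PiE UNIV (\<lambda>i::nat. A). route_length \<sigma> n \<xi> \<le> route_length \<sigma> n \<eta>"
    using continuous_attains_inf by metis
  then show ?thesis
    unfolding shortest_def by (intro exI[of _ \<xi>]) (auto simp: PiE_def Pi_def image_subset_iff)
qed

definition heading :: "(nat \<Rightarrow> int) \<Rightarrow> (nat \<Rightarrow> complex) \<Rightarrow> nat \<Rightarrow> complex" where
  "heading \<sigma> \<xi> i = sgn (hop (\<sigma> i) (\<xi> i) (\<xi> (Suc i)))"

text \<open>The sum of the unit vectors from \<open>\<xi> i\<close> to its neighbours on the route, in folded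
  coordinates: the backward direction of the hop that arrives is mirrored once more, which gives
  \<open>cnj\<close>.\<close>

definition normal :: "(nat \<Rightarrow> int) \<Rightarrow> nat \<Rightarrow> (nat \<Rightarrow> complex) \<Rightarrow> nat \<Rightarrow> complex" where
  "normal \<sigma> n \<xi> i = (if i < n then heading \<sigma> \<xi> i else 0) + (if 0 < i then cnj (heading \<sigma> \<xi> (i - 1)) else 0)"

text \<open>Moving one vertex affects the at most two hops that meet there.\<close>

lemma route_length_move:
  "route_length \<sigma> n (\<xi>(i := x)) - route_length \<sigma> n \<xi> =
     (if i < n then norm (hop (\<sigma> i) x (\<xi> (Suc i))) - norm (hop (\<sigma> i) (\<xi> i) (\<xi> (Suc i))) else 0) +
     (if 0 < i \<and> i \<le> n then norm (hop (\<sigma> (i - 1)) (\<xi> (i - 1)) x)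
        - norm (hop (\<sigma> (i - 1)) (\<xi> (i - 1)) (\<xi> i)) else 0)"
proof -
  define \<eta> where "\<eta> = \<xi>(i := x)"
  have "route_length \<sigma> n \<eta> - route_length \<sigma> n \<xi> =
      (\<Sum>j<n. norm (hop (\<sigma> j) (\<eta> j) (\<eta> (Suc j))) - norm (hop (\<sigma> j) (\<xi> j) (\<xi> (Suc j))))"
    by (simp add: route_length_def sum_subtractf)
  also have "\<dots> = (\<Sum>j<n. (if j = i then norm (hop (\<sigma> i) x (\<xi> (Suc i))) - norm (hop (\<sigma> i) (\<xi> i) (\<xi> (Suc i))) else 0)
     + (if j = i - 1 then (if 0 < i then norm (hop (\<sigma> (i - 1)) (\<xi> (i - 1)) x)
        - norm (hop (\<sigma> (i - 1)) (\<xi> (i - 1)) (\<xi> i)) else 0) else 0))"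
    by (intro sum.cong) (auto simp: \<eta>_def)
  also have "\<dots> = (if i < n then norm (hop (\<sigma> i) x (\<xi> (Suc i))) - norm (hop (\<sigma> i) (\<xi> i) (\<xi> (Suc i))) else 0) +
     (if 0 < i \<and> i \<le> n then norm (hop (\<sigma> (i - 1)) (\<xi> (i - 1)) x)
        - norm (hop (\<sigma> (i - 1)) (\<xi> (i - 1)) (\<xi> i)) else 0)"
    by (auto simp: sum.distrib)
  finally show ?thesis
    by (simp add: \<eta>_def)
qed

context
  fixes \<sigma> n \<xi>
  assumes shortest: "shortest \<sigma> n \<xi>" and n_pos: "0 < n"
begin

lemma \<xi>_in_A: "\<xi> i \<in> A"
  using shortest by (auto simp: shortest_def)

lemma norm_heading: "norm (heading \<sigma> \<xi> i) = 1"
  using Re_hop_pos[OF \<xi>_in_A[of i] \<xi>_in_A[of "Suc i"], of "\<sigma> i"] by (auto simp: heading_def norm_sgn)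

lemma Re_heading_pos: "0 < Re (heading \<sigma> \<xi> i)"
  using Re_hop_pos[OF \<xi>_in_A[of i] \<xi>_in_A[of "Suc i"], of "\<sigma> i"]
  by (auto simp: heading_def sgn_div_norm intro!: mult_pos_pos)

text \<open>The first-order condition at each vertex of a shortest route. This one family of inequalities
  yields the reflection law, the fact that the route avoids the obstacle between reflections, and the
  fact that near a reflection it stays off the ray to the left of \<open>z\<close>.\<close>

lemma normal_supports:
  assumes "i \<le> n" "y \<in> A"
  shows "inner (y - \<xi> i) (normal \<sigma> n \<xi> i) \<le> 0"
proof -
  \<comment> \<open>where the neighbours appear in the folded picture; at the ends of the route the missing
    neighbour is replaced by a dummy point different from \<open>\<xi> i\<close>, with weight zero\<close>
  define p where "p = (if i < n then \<xi> i + hop (\<sigma> i) (\<xi> i) (\<xi> (Suc i)) else \<xi> i + 1)"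
  define q where "q = (if 0 < i then \<xi> i + cnj (hop (\<sigma> (i - 1)) (\<xi> (i - 1)) (\<xi> i)) else \<xi> i + 1)"
  define c :: real where "c = of_bool (i < n)"
  define d :: real where "d = of_bool (0 < i)"
  have hop_nz: "hop s (\<xi> j) (\<xi> k) \<noteq> 0" for s j k
    using Re_hop_pos[OF \<xi>_in_A[of j] \<xi>_in_A[of k], of s] by auto
  have cn: "c * norm (p - x) = (if i < n then norm (hop (\<sigma> i) x (\<xi> (Suc i))) else 0)" for x
    by (simp add: c_def p_def hop_def diff_diff_eq add.commute)
  have "norm (q - x) = norm (hop (\<sigma> (i - 1)) (\<xi> (i - 1)) x)" if "0 < i" for x
  proof -
    have "q - x = cnj (hop (\<sigma> (i - 1)) (\<xi> (i - 1)) x)"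
      using that by (simp add: q_def hop_def complex_eq_iff)
    then show ?thesis by simp
  qed
  then have dn: "d * norm (q - x) = (if 0 < i then norm (hop (\<sigma> (i - 1)) (\<xi> (i - 1)) x) else 0)" for x
    by (simp add: d_def)
  have "c * norm (p - \<xi> i) + d * norm (q - \<xi> i) \<le> c * norm (p - x) + d * norm (q - x)" if "x \<in> A" for x
  proof -
    have "range (\<xi>(i := x)) \<subseteq> A"
      using that \<xi>_in_A by auto
    then have "0 \<le> route_length \<sigma> n (\<xi>(i := x)) - route_length \<sigma> n \<xi>"
      using shortest by (simp add: shortest_def)
    then show ?thesis
      unfolding route_length_move cn dn using assms(1) by (auto split: if_splits)
  qed
  then have "inner (y - \<xi> i) (c *\<^sub>R sgn (p - \<xi> i) + d *\<^sub>R sgn (q - \<xi> i)) \<le> 0"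
    using \<xi>_in_A assms(2) hop_nz
    by (intro shortest_detour_support[OF convex_A]) (auto simp: c_def d_def p_def q_def)
  moreover have "sgn (cnj h) = cnj (sgn h)" for h
    by (simp add: sgn_div_norm complex_eq_iff)
  ultimately show ?thesis
    by (simp add: normal_def c_def d_def p_def q_def heading_def split: if_splits)
qed

lemma Re_normal_pos: "i \<le> n \<Longrightarrow> 0 < Re (normal \<sigma> n \<xi> i)"
  using Re_heading_pos[of i] Re_heading_pos[of "i - 1"] n_pos by (auto simp: normal_def)

lemma normal_heading_pos: "i < n \<Longrightarrow> 0 < inner (heading \<sigma> \<xi> i) (normal \<sigma> n \<xi> i)"
  using right_half_plane_not_opposite[of "heading \<sigma> \<xi> i" "cnj (heading \<sigma> \<xi> (i - 1))"]
    norm_heading Re_heading_pos norm_heading[of i, unfolded norm_eq_1]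
  by (auto simp: normal_def inner_add_right)

lemma normal_backward_pos:
  assumes "0 < i" "i \<le> n"
  shows "0 < inner (cnj (heading \<sigma> \<xi> (i - 1))) (normal \<sigma> n \<xi> i)"
proof -
  have "inner (cnj (heading \<sigma> \<xi> (i - 1))) (cnj (heading \<sigma> \<xi> (i - 1))) = 1"
    using norm_heading[of "i - 1"] unfolding norm_eq_1[symmetric] by simp
  then show ?thesis
    using right_half_plane_not_opposite[of "cnj (heading \<sigma> \<xi> (i - 1))" "heading \<sigma> \<xi> i"]
      norm_heading Re_heading_pos assms by (auto simp: normal_def inner_add_right)
qed

text \<open>Both directions in which a trajectory can be followed away from the obstacle.\<close>

text \<open>Forwards along the next hop or backwards along the previous one: by symmetry both directions
  behave alike.\<close>

definition away :: "nat \<Rightarrow> complex \<Rightarrow> bool" where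
  "away i w \<longleftrightarrow> i < n \<and> w = heading \<sigma> \<xi> i \<or> 0 < i \<and> i \<le> n \<and> w = cnj (heading \<sigma> \<xi> (i - 1))"

lemma away_normal: "away i w \<Longrightarrow> i \<le> n \<and> 0 < inner w (normal \<sigma> n \<xi> i)"
  using normal_heading_pos normal_backward_pos unfolding away_def by fastforce

lemma away_not_in_A:
  assumes "away i w" "0 < t"
  shows "\<xi> i + t *\<^sub>R w \<notin> A"
  using normal_supports[of i "\<xi> i + t *\<^sub>R w"] away_normal[OF assms(1)] assms(2)
  by (auto simp: mult_le_0_iff)

text \<open>A point \<open>z\<close> of the interior lies strictly on the inner side of the support line at
  \<open>\<xi> i\<close>. A vector from \<open>z\<close> to a point in an \<open>away\<close> direction has a
  positive normal component, whereas the ray to the left of \<open>z\<close> goes further inwards since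
  the normal points to the right.\<close>

lemma away_slit:
  assumes "away i w" "0 \<le> t" "z \<in> interior A"
  shows "\<xi> i + t *\<^sub>R w - z \<notin> \<real>\<^sub>\<le>\<^sub>0"
proof
  assume "\<xi> i + t *\<^sub>R w - z \<in> \<real>\<^sub>\<le>\<^sub>0"
  then obtain r where r: "r \<le> 0" "\<xi> i + t *\<^sub>R w - z = of_real r"
    by (auto elim: nonpos_Reals_cases)
  have i: "i \<le> n" using away_normal[OF assms(1)] by simp
  have "normal \<sigma> n \<xi> i \<noteq> 0"
    using Re_normal_pos[OF i] by auto
  then have "inner (z - \<xi> i) (normal \<sigma> n \<xi> i) < 0"
    using support_interior_neg[of A "\<xi> i"] normal_supports[OF i] assms(3) by blast
  moreover have "z - \<xi> i = t *\<^sub>R w - of_real r"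
    using r(2) by (simp add: algebra_simps)
  then have "inner (z - \<xi> i) (normal \<sigma> n \<xi> i) =
      t * inner w (normal \<sigma> n \<xi> i) - r * Re (normal \<sigma> n \<xi> i)"
    by (simp add: inner_diff_left) (simp add: inner_complex_def)
  moreover have "0 \<le> t * inner w (normal \<sigma> n \<xi> i)"
    using away_normal[OF assms(1)] assms(2) by simp
  moreover have "r * Re (normal \<sigma> n \<xi> i) \<le> 0"
    using r(1) Re_normal_pos[OF i] by (simp add: mult_le_0_iff)
  ultimately show False by linarith
qed

lemma \<xi>_frontier:
  assumes "i \<le> n"
  shows "\<xi> i \<in> frontier A" "\<xi> i \<notin> interior A"
proof -
  have "normal \<sigma> n \<xi> i \<noteq> 0"
    using Re_normal_pos[OF assms] by auto
  then show "\<xi> i \<notin> interior A"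
    using support_interior_neg[of A "\<xi> i" "normal \<sigma> n \<xi> i" "\<xi> i"] normal_supports[OF assms] by auto
  then show "\<xi> i \<in> frontier A"
    using \<xi>_in_A closure_subset by (auto simp: frontier_def)
qed

text \<open>The velocities before and after the reflection are \<open>- cnj (heading (i - 1))\<close> and
  \<open>heading i\<close>; their difference is the normal vector.\<close>

lemma shortest_reflects:
  assumes "0 < i" "i < n"
  shows "obstacle_law A (\<xi> i) (- cnj (heading \<sigma> \<xi> (i - 1))) (heading \<sigma> \<xi> i)"
proof -
  let ?u = "- cnj (heading \<sigma> \<xi> (i - 1))" and ?v = "heading \<sigma> \<xi> i"
  have \<nu>: "normal \<sigma> n \<xi> i = ?v - ?u"
    using assms by (simp add: normal_def)
  have "?v \<noteq> ?u"
    using Re_normal_pos[of i] \<nu> assms by auto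
  moreover have "outer_unit_normal A (\<xi> i) (sgn (?v - ?u))"
    unfolding outer_unit_normal_def
  proof (intro conjI ballI)
    show "norm (sgn (?v - ?u)) = 1"
      using \<open>?v \<noteq> ?u\<close> by (simp add: norm_sgn del: diff_minus_eq_add)
    fix y assume "y \<in> A"
    then have "inner (y - \<xi> i) (?v - ?u) \<le> 0"
      using normal_supports[of i y] assms unfolding \<nu> by simp
    then show "inner (y - \<xi> i) (sgn (?v - ?u)) \<le> 0"
      unfolding sgn_div_norm inner_scaleR_right by (intro mult_nonneg_nonpos) simp_all
  qed
  moreover have "?v = ?u - (2 * inner ?u (sgn (?v - ?u))) *\<^sub>R sgn (?v - ?u)"
    using \<open>?v \<noteq> ?u\<close> norm_heading by (intro reflection_in_bisector) auto
  ultimately show ?thesis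
    unfolding obstacle_law_def by blast
qed

end

end

section \<open>Zigzag itineraries\<close>

lemma hull_inner_le:
  fixes c :: complex
  assumes "\<And>w. w \<in> S \<Longrightarrow> inner c w \<le> b" "x \<in> convex hull S"
  shows "inner c x \<le> b"
proof -
  have "convex hull S \<subseteq> {w. inner c w \<le> b}"
    using assms(1) by (intro hull_minimal convex_halfspace_le) auto
  then show ?thesis using assms(2) by blast
qed

context tiny_obstacle
begin

lemma obstacle_copy_near_centre:
  assumes "w \<in> obstacle_copy A k"
  shows "norm (w - centre k) \<le> \<rho>"
  using assms A_norm by (auto simp: obstacle_copy_def to_cell_flip)

lemma closed_obstacle_copy: "closed (obstacle_copy A k)"
  unfolding obstacle_copy_flip
  by (intro compact_imp_closed compact_translation compact_continuous_image compact_A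
      linear_continuous_on linear_conv_bounded_linear[THEN iffD1] linear_flip)

lemma inner_obstacle_copy:
  assumes "w \<in> obstacle_copy A k"
  shows "\<bar>inner c w - inner c (centre k)\<bar> \<le> norm c * \<rho>"
proof -
  have "\<bar>inner c (w - centre k)\<bar> \<le> norm c * norm (w - centre k)"
    by (rule Cauchy_Schwarz_ineq2)
  also have "\<dots> \<le> norm c * \<rho>"
    using obstacle_copy_near_centre[OF assms] by (intro mult_left_mono) auto
  finally show ?thesis
    by (simp add: inner_diff_right)
qed

text \<open>A linear functional sees every obstacle within \<open>norm c * \<rho>\<close> of its centre. So an
  obstacle whose centre is beyond the two others by twice this amount is not between them.\<close>

lemma between_inner_le:
  assumes "between A m j k"
  shows "inner c (centre m) \<le> max (inner c (centre j)) (inner c (centre k)) + 2 * (norm c * \<rho>)"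
proof -
  obtain p where p: "p \<in> obstacle_copy A m" "p \<in> convex hull (obstacle_copy A j \<union> obstacle_copy A k)"
    using assms unfolding between_def by blast
  have "inner c p \<le> max (inner c (centre j)) (inner c (centre k)) + norm c * \<rho>"
    using p(2) by (rule hull_inner_le[rotated]) (use inner_obstacle_copy[of _ _ c] in fastforce)
  then show ?thesis
    using inner_obstacle_copy[OF p(1), of c] by linarith
qed

lemma obstacle_copies_disjoint:
  assumes "w \<in> obstacle_copy A k" "w \<in> obstacle_copy A m"
  shows "k = m"
proof -
  have "norm (centre k - centre m) < 1"
    using norm_triangle_le_diff[of "w - centre m" "w - centre k" "\<rho> + \<rho>"]
      obstacle_copy_near_centre[OF assms(1)] obstacle_copy_near_centre[OF assms(2)] \<rho>_bound by auto
  then have "\<bar>Re (centre k - centre m)\<bar> < 1" "\<bar>Im (centre k - centre m)\<bar> < 1"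
    using abs_Re_le_cmod abs_Im_le_cmod le_less_trans by blast+
  then have "\<bar>fst k - fst m\<bar> < 1" "\<bar>snd k - snd m\<bar> < 1"
    by (simp_all only: centre_sel minus_complex.sel flip: of_int_diff of_int_abs)
  then show ?thesis
    by (simp add: prod_eq_iff)
qed

text \<open>Take the functional \<open>c\<close> that vanishes on the hop vector. On lattice vectors it has
  integer values, so the centre of an obstacle in between must lie on the line through the two other
  centres. Since \<open>N\<close> and \<open>N + 1\<close> are coprime, the lattice points of this line
  outside the two ends are beyond the ends, which the first coordinate detects.\<close>

lemma no_obstacle_along_hop:
  assumes s: "\<bar>s\<bar> = 1" "\<bar>r\<bar> = 1"
    and k': "k' = (fst k + r * (int N + 1), snd k + s * int N)"
  shows "\<not> between A m k k'"
proof
  assume bt: "between A m k k'"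
  define a b where "a = fst m - fst k" and "b = snd m - snd k"
  define c where "c = Complex (of_int (s * int N)) (- of_int (r * (int N + 1)))"
  have "norm c \<le> \<bar>Re c\<bar> + \<bar>Im c\<bar>"
    by (rule cmod_le)
  also have "\<dots> = 2 * real N + 1"
    using s by (simp add: c_def abs_mult flip: of_int_abs)
  finally have "norm c * \<rho> \<le> (2 * real N + 1) * \<rho>"
    using \<rho>_nonneg by (rule mult_right_mono)
  also have "\<dots> \<le> 2 * ((real N + 2) * \<rho>)"
    using \<rho>_nonneg by (simp add: algebra_simps)
  finally have c_le: "norm c * \<rho> \<le> 2 * ((real N + 2) * \<rho>)" .
  have small: "2 * (norm c * \<rho>) < 1"
  proof -
    have "16 * ((real N + 2) * \<rho>) < 1"
      using \<rho>_small by (simp only: mult.assoc)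
    moreover have "0 \<le> (real N + 2) * \<rho>"
      using \<rho>_nonneg by simp
    ultimately show ?thesis using c_le by linarith
  qed
  have ends: "inner c (centre k') = inner c (centre k)"
    by (simp add: k' c_def inner_complex_def algebra_simps)
  have "inner c (centre m) - inner c (centre k) = of_int (a * (s * int N) - b * (r * (int N + 1)))"
    by (simp add: c_def inner_complex_def a_def b_def algebra_simps)
  moreover have "\<bar>inner c (centre m) - inner c (centre k)\<bar> < 1"
    using between_inner_le[OF bt, of c] between_inner_le[OF bt, of "- c"] ends small by simp
  ultimately have "\<bar>real_of_int (a * (s * int N) - b * (r * (int N + 1)))\<bar> < 1"
    by simp
  then have "\<bar>a * (s * int N) - b * (r * (int N + 1))\<bar> < 1"
    by linarith
  then have det: "a * (s * int N) = b * (r * (int N + 1))"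
    by simp
  have "int N + 1 dvd a * (s * int N)"
    unfolding det by simp
  moreover have "coprime (int N + 1) (int N)"
    by (simp add: coprime_add_one_left)
  moreover have "coprime (int N + 1) s"
    using s(1) by (auto simp: abs_eq_iff abs_if split: if_splits)
  ultimately have "int N + 1 dvd a"
    by (simp add: coprime_dvd_mult_left_iff)
  then obtain t where t: "a = (int N + 1) * t"
    by (elim dvdE)
  have ss: "s * s = 1" "r * r = 1"
    using s by (auto simp: abs_if split: if_splits)
  have "(int N + 1) * (t * s * int N) = (int N + 1) * (b * r)"
    using det t by (simp add: algebra_simps)
  then have "t * s * int N = b * r"
    by simp
  then have "t * s * int N * r = b * (r * r)"
    by simp
  then have b: "b = t * s * r * int N"
    using ss by (simp add: algebra_simps)
  \<comment> \<open>the position of \<open>m\<close> on the line in multiples of the hop; the ends are \<open>0\<close> and \<open>1\<close>\<close>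
  define u where "u = r * t"
  have "t = r * u"
    using ss by (simp add: u_def flip: mult.assoc)
  have "u \<noteq> 0"
    using bt t b \<open>t = r * u\<close> unfolding between_def a_def b_def by (auto simp: prod_eq_iff)
  moreover have "u \<noteq> 1"
  proof
    assume "u = 1"
    then have "t = r" using \<open>t = r * u\<close> by simp
    then have "a = r * (int N + 1)" "b = s * int N * (r * r)"
      using t b by (simp_all add: algebra_simps)
    then have "m = k'"
      using ss unfolding k' a_def b_def by (auto simp: prod_eq_iff)
    then show False
      using bt by (simp add: between_def)
  qed
  ultimately have "u \<ge> 2 \<or> u \<le> -1"
    by linarith
  moreover have "(real N + 1) * u \<le> real N + 1 + 2 * \<rho> \<and> - 2 * \<rho> \<le> (real N + 1) * u"
  proof -
    have nr: "norm (complex_of_real (of_int r)) = 1"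
      using s(2) by (auto simp: abs_if split: if_splits)
    have "real_of_int r * real_of_int r = 1"
      using ss(2) by (metis of_int_1 of_int_mult)
    then have "of_int r * (real_of_int (fst k') - of_int (fst k)) = real N + 1"
      by (simp add: k' algebra_simps flip: mult.assoc)
    moreover have "of_int r * (real_of_int (fst m) - of_int (fst k)) = (real N + 1) * u"
    proof -
      have "fst m - fst k = (int N + 1) * t" using t a_def by simp
      then have "real_of_int (fst m - fst k) = real_of_int ((int N + 1) * t)"
        by simp
      then have "real_of_int (fst m) - of_int (fst k) = (real N + 1) * of_int t"
        by simp
      then show ?thesis
        by (simp add: u_def)
    qed
    ultimately show ?thesis
      using between_inner_le[OF bt, of "of_real (of_int r)"]
        between_inner_le[OF bt, of "- of_real (of_int r)"] nr
      by (simp add: inner_complex_def right_diff_distrib)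
  qed
  ultimately show False
  proof (elim disjE conjE)
    assume "u \<ge> 2" "(real N + 1) * u \<le> real N + 1 + 2 * \<rho>"
    moreover from this have "(real N + 1) * u \<ge> (real N + 1) * 2"
      by (intro mult_left_mono) auto
    ultimately show False using \<rho>_bound by simp
  next
    assume "u \<le> -1" "- 2 * \<rho> \<le> (real N + 1) * u"
    moreover from this have "(real N + 1) * u \<le> (real N + 1) * (-1)"
      by (intro mult_left_mono) auto
    ultimately show False using \<rho>_bound by simp
  qed
qed

text \<open>The itinerary with signs \<open>\<sigma>\<close>: the first coordinate alternates between
  \<open>0\<close> and \<open>N + 1\<close>, the second one moves by \<open>\<sigma> i * N\<close>.\<close>

definition zigzag :: "(nat \<Rightarrow> int) \<Rightarrow> nat \<Rightarrow> int \<times> int" where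
  "zigzag \<sigma> i = (if even i then 0 else int N + 1, int N * (\<Sum>j<i. \<sigma> j))"

lemma zigzag_Suc:
  "zigzag \<sigma> (Suc i) = (fst (zigzag \<sigma> i) + (if even i then 1 else - 1) * (int N + 1), snd (zigzag \<sigma> i) + \<sigma> i * int N)"
  by (auto simp: zigzag_def algebra_simps)

lemma flip_zigzag: "flip (zigzag \<sigma> i) w = (if even i then w else - cnj w)"
  using even_N by (auto simp: zigzag_def complex_eq_iff powi_minus_one)

lemma zigzag_turns: "\<not> between A (zigzag \<sigma> (Suc i)) (zigzag \<sigma> i) (zigzag \<sigma> (Suc (Suc i)))"
proof
  assume bt: "between A (zigzag \<sigma> (Suc i)) (zigzag \<sigma> i) (zigzag \<sigma> (Suc (Suc i)))"
  show False
    using between_inner_le[OF bt, of 1] between_inner_le[OF bt, of "-1"] \<rho>_bound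
    by (cases "even i") (auto simp: zigzag_def inner_complex_def)
qed

lemma zigzag_edge:
  assumes "\<bar>\<sigma> i\<bar> = 1"
  shows "\<not> between A m (zigzag \<sigma> i) (zigzag \<sigma> (Suc i))"
  using no_obstacle_along_hop[OF assms, of "if even i then 1 else - 1"] zigzag_Suc[of \<sigma> i] by simp

lemma zigzag_admissible:
  assumes "\<And>i. \<bar>\<sigma> i\<bar> = 1"
  shows "admissible A (map (zigzag \<sigma>) [0..<Suc n])"
proof -
  have nth: "map (zigzag \<sigma>) [0..<Suc n] ! i = zigzag \<sigma> i" if "i < Suc n" for i
    using that by (metis add_0 diff_zero length_upt nth_map nth_upt)
  have "zigzag \<sigma> (Suc i) \<noteq> zigzag \<sigma> i" for i
    unfolding zigzag_Suc[of \<sigma> i] by (auto simp: prod_eq_iff)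
  then show ?thesis
    using zigzag_edge[OF assms] zigzag_turns
    by (auto simp: admissible_def nth simp del: upt_Suc) (simp add: zigzag_def)
qed

definition bounce :: "(nat \<Rightarrow> int) \<Rightarrow> (nat \<Rightarrow> complex) \<Rightarrow> nat \<Rightarrow> complex" where
  "bounce \<sigma> \<xi> i = to_cell (zigzag \<sigma> i) (\<xi> i)"

lemma bounce_step:
  "bounce \<sigma> \<xi> (Suc i) - bounce \<sigma> \<xi> i = flip (zigzag \<sigma> i) (hop (\<sigma> i) (\<xi> i) (\<xi> (Suc i)))"
  using even_N
  by (simp add: bounce_def to_cell_flip complex_eq_iff hop_def)
     (auto simp: zigzag_def algebra_simps powi_minus_one)

lemma vertex_time_bounce: "vertex_time (bounce \<sigma> \<xi>) i = route_length \<sigma> i \<xi>"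
  by (simp add: vertex_time_def route_length_def bounce_step)

lemma sgn_flip: "sgn (flip k w) = flip k (sgn w)"
  by (simp add: sgn_div_norm linear_scale[OF linear_flip])

lemma bounce_direction:
  "sgn (bounce \<sigma> \<xi> (Suc i) - bounce \<sigma> \<xi> i) = flip (zigzag \<sigma> i) (heading \<sigma> \<xi> i)"
  by (simp add: bounce_step heading_def sgn_flip)

lemma bounce_forward:
  "bounce \<sigma> \<xi> i + t *\<^sub>R flip (zigzag \<sigma> i) w = to_cell (zigzag \<sigma> i) (\<xi> i + t *\<^sub>R w)"
  by (simp add: bounce_def to_cell_flip linear_add[OF linear_flip] linear_scale[OF linear_flip])

context
  fixes \<sigma> n \<xi>
  assumes shortest: "shortest \<sigma> n \<xi>" and n_pos: "0 < n" and signs: "\<And>i. \<bar>\<sigma> i\<bar> = 1"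
begin

text \<open>The copies at both ends are avoided because an edge leaves them in an \<open>away\<close> direction,
  all others because they would be between the two ends.\<close>

lemma edge_avoids_obstacles:
  assumes "i < n" "0 < t" "t < norm (hop (\<sigma> i) (\<xi> i) (\<xi> (Suc i)))"
  shows "bounce \<sigma> \<xi> i + t *\<^sub>R flip (zigzag \<sigma> i) (heading \<sigma> \<xi> i) \<notin> obstacle_copy A k"
proof
  let ?p = "bounce \<sigma> \<xi> i + t *\<^sub>R flip (zigzag \<sigma> i) (heading \<sigma> \<xi> i)"
  let ?l = "norm (hop (\<sigma> i) (\<xi> i) (\<xi> (Suc i)))"
  assume p: "?p \<in> obstacle_copy A k"
  have end_point: "bounce \<sigma> \<xi> (Suc i) = bounce \<sigma> \<xi> i + ?l *\<^sub>R flip (zigzag \<sigma> i) (heading \<sigma> \<xi> i)"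
    using bounce_step[of \<sigma> \<xi> i] norm_scaleR_sgn[of "hop (\<sigma> i) (\<xi> i) (\<xi> (Suc i))"]
    by (simp add: heading_def algebra_simps flip: linear_scale[OF linear_flip])
  have "k \<noteq> zigzag \<sigma> i"
  proof
    assume "k = zigzag \<sigma> i"
    then have "\<xi> i + t *\<^sub>R heading \<sigma> \<xi> i \<in> A"
      using p inj_to_cell unfolding bounce_forward by (auto simp: obstacle_copy_def inj_image_mem_iff)
    then show False
      using away_not_in_A[OF shortest n_pos] assms unfolding away_def[OF shortest n_pos] by blast
  qed
  moreover have "k \<noteq> zigzag \<sigma> (Suc i)"
  proof
    assume k: "k = zigzag \<sigma> (Suc i)"
    have "?p = bounce \<sigma> \<xi> (Suc i) + (?l - t) *\<^sub>R flip (zigzag \<sigma> (Suc i)) (cnj (heading \<sigma> \<xi> i))"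
      unfolding end_point flip_zigzag by (auto simp: algebra_simps)
    then have "\<xi> (Suc i) + (?l - t) *\<^sub>R cnj (heading \<sigma> \<xi> i) \<in> A"
      using p inj_to_cell unfolding k bounce_forward by (auto simp: obstacle_copy_def inj_image_mem_iff)
    then show False
      using away_not_in_A[OF shortest n_pos, of "Suc i" "cnj (heading \<sigma> \<xi> i)" "?l - t"] assms
      unfolding away_def[OF shortest n_pos] by auto
  qed
  ultimately have "between A k (zigzag \<sigma> i) (zigzag \<sigma> (Suc i))"
  proof -
    have "bounce \<sigma> \<xi> j \<in> obstacle_copy A (zigzag \<sigma> j)" for j
      using \<xi>_in_A[OF shortest n_pos] by (auto simp: bounce_def obstacle_copy_def)
    then have "bounce \<sigma> \<xi> i \<in> convex hull (obstacle_copy A (zigzag \<sigma> i) \<union> obstacle_copy A (zigzag \<sigma> (Suc i)))"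
        "bounce \<sigma> \<xi> (Suc i) \<in> convex hull (obstacle_copy A (zigzag \<sigma> i) \<union> obstacle_copy A (zigzag \<sigma> (Suc i)))"
      by (auto intro: hull_inc)
    then have "(1 - t / ?l) *\<^sub>R bounce \<sigma> \<xi> i + (t / ?l) *\<^sub>R bounce \<sigma> \<xi> (Suc i)
        \<in> convex hull (obstacle_copy A (zigzag \<sigma> i) \<union> obstacle_copy A (zigzag \<sigma> (Suc i)))"
      using assms by (intro convexD_alt convex_convex_hull) (auto simp: divide_le_eq_1)
    moreover have "(1 - t / ?l) *\<^sub>R bounce \<sigma> \<xi> i + (t / ?l) *\<^sub>R bounce \<sigma> \<xi> (Suc i) = ?p"
      unfolding end_point using assms by (auto simp: algebra_simps)
    ultimately show ?thesis
      using p \<open>k \<noteq> zigzag \<sigma> i\<close> \<open>k \<noteq> zigzag \<sigma> (Suc i)\<close> unfolding between_def by force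
  qed
  then show False
    using zigzag_edge signs by blast
qed

lemma route_plane_trajectory:
  "plane_trajectory A (route_length \<sigma> n \<xi>) (polyline (bounce \<sigma> \<xi>) n)"
  "{t \<in> {0<..<route_length \<sigma> n \<xi>}. reflects_at (polyline (bounce \<sigma> \<xi>) n) t}
     = vertex_time (bounce \<sigma> \<xi>) ` {0<..<n}"
  "strict_mono_on {0..n} (vertex_time (bounce \<sigma> \<xi>))"
proof -
  note facts = shortest n_pos
  have step_nz: "bounce \<sigma> \<xi> (Suc i) \<noteq> bounce \<sigma> \<xi> i" for i
  proof -
    have "norm (bounce \<sigma> \<xi> (Suc i) - bounce \<sigma> \<xi> i) = norm (hop (\<sigma> i) (\<xi> i) (\<xi> (Suc i)))"
      by (simp add: bounce_step)
    moreover have "hop (\<sigma> i) (\<xi> i) (\<xi> (Suc i)) \<noteq> 0"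
      using Re_hop_pos[OF \<xi>_in_A[OF facts, of i] \<xi>_in_A[OF facts, of "Suc i"], of "\<sigma> i"] by auto
    ultimately show ?thesis by auto
  qed
  have vertex: "bounce \<sigma> \<xi> i \<notin> interior (obstacle_copy A k)" if "i \<le> n" for i k
  proof
    assume "bounce \<sigma> \<xi> i \<in> interior (obstacle_copy A k)"
    moreover have "bounce \<sigma> \<xi> i \<in> obstacle_copy A (zigzag \<sigma> i)"
      using \<xi>_in_A[OF facts] by (auto simp: bounce_def obstacle_copy_def)
    ultimately have "k = zigzag \<sigma> i"
      using obstacle_copies_disjoint interior_subset by blast
    then have "\<xi> i \<in> interior A"
      using \<open>bounce \<sigma> \<xi> i \<in> interior (obstacle_copy A k)\<close> inj_to_cell
      unfolding interior_obstacle_copy bounce_def by (simp add: inj_image_mem_iff)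
    then show False
      using \<xi>_frontier[OF facts that] by simp
  qed
  have edge: "bounce \<sigma> \<xi> i + t *\<^sub>R sgn (bounce \<sigma> \<xi> (Suc i) - bounce \<sigma> \<xi> i) \<notin> obstacle_copy A k"
    if "i < n" "0 < t" "t < norm (bounce \<sigma> \<xi> (Suc i) - bounce \<sigma> \<xi> i)" for i t k
    using edge_avoids_obstacles[OF that(1,2)] that(3) unfolding bounce_direction by (simp add: bounce_step)
  have law: "plane_law A (bounce \<sigma> \<xi> (Suc i)) (sgn (bounce \<sigma> \<xi> (Suc i) - bounce \<sigma> \<xi> i))
      (sgn (bounce \<sigma> \<xi> (Suc (Suc i)) - bounce \<sigma> \<xi> (Suc i)))" if "Suc i < n" for i
  proof -
    have "flip (zigzag \<sigma> i) (heading \<sigma> \<xi> i) = flip (zigzag \<sigma> (Suc i)) (- cnj (heading \<sigma> \<xi> i))"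
      by (simp add: flip_zigzag)
    then have "obstacle_law (obstacle_copy A (zigzag \<sigma> (Suc i))) (bounce \<sigma> \<xi> (Suc i))
        (flip (zigzag \<sigma> i) (heading \<sigma> \<xi> i)) (flip (zigzag \<sigma> (Suc i)) (heading \<sigma> \<xi> (Suc i)))"
      using obstacle_law_unfold[OF shortest_reflects[OF facts, of "Suc i"], of "zigzag \<sigma> (Suc i)"] that
      by (simp add: bounce_def)
    moreover have vf: "bounce \<sigma> \<xi> (Suc i) \<in> frontier (obstacle_copy A (zigzag \<sigma> (Suc i)))"
      using \<xi>_frontier[OF facts, of "Suc i"] that
      unfolding frontier_obstacle_copy[OF compact_A] bounce_def by simp
    moreover have "k = zigzag \<sigma> (Suc i)" if "bounce \<sigma> \<xi> (Suc i) \<in> frontier (obstacle_copy A k)" for k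
      using that vf frontier_subset_closed[OF closed_obstacle_copy] obstacle_copies_disjoint by blast
    ultimately show ?thesis
      unfolding plane_law_def bounce_direction by blast
  qed
  have turn: "sgn (bounce \<sigma> \<xi> (Suc i) - bounce \<sigma> \<xi> i) \<noteq> sgn (bounce \<sigma> \<xi> (Suc (Suc i)) - bounce \<sigma> \<xi> (Suc i))" for i
    using Re_heading_pos[OF facts, of i] Re_heading_pos[OF facts, of "Suc i"]
    unfolding bounce_direction flip_zigzag by (auto simp: complex_eq_iff)
  show "plane_trajectory A (route_length \<sigma> n \<xi>) (polyline (bounce \<sigma> \<xi>) n)"
    "{t \<in> {0<..<route_length \<sigma> n \<xi>}. reflects_at (polyline (bounce \<sigma> \<xi>) n) t}
       = vertex_time (bounce \<sigma> \<xi>) ` {0<..<n}"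
    "strict_mono_on {0..n} (vertex_time (bounce \<sigma> \<xi>))"
    using polyline_trajectory[where x = "bounce \<sigma> \<xi>" and s = n and A = A, OF n_pos step_nz vertex edge closed_obstacle_copy law turn]
    unfolding vertex_time_bounce by simp_all
qed

text \<open>The folded shortest polygon: the trajectory in the square.\<close>

definition route :: "real \<Rightarrow> complex" where
  "route t = fold_plane (polyline (bounce \<sigma> \<xi>) n t)"

lemma A_in_square: "w \<in> A \<Longrightarrow> w \<in> unit_square"
  using A_coords[of w] \<rho>_bound by (simp add: unit_square_def)

lemma route_on_edge:
  assumes "i < n" "route_length \<sigma> i \<xi> \<le> t" "t \<le> route_length \<sigma> (Suc i) \<xi>"
  shows "route t = fold_plane (\<xi> i + (t - route_length \<sigma> i \<xi>) *\<^sub>R heading \<sigma> \<xi> i)"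
proof -
  have "polyline (bounce \<sigma> \<xi>) n t = bounce \<sigma> \<xi> i
      + (t - route_length \<sigma> i \<xi>) *\<^sub>R flip (zigzag \<sigma> i) (heading \<sigma> \<xi> i)"
    using polyline_on_edge[of i n "bounce \<sigma> \<xi>" t] assms
    unfolding vertex_time_bounce bounce_direction by simp
  then show ?thesis
    unfolding route_def bounce_forward by (simp add: fold_plane_to_cell)
qed

lemma route_at_bounce:
  assumes "i \<le> n"
  shows "route (route_length \<sigma> i \<xi>) = \<xi> i"
  using polyline_at_vertex[OF assms n_pos, of "bounce \<sigma> \<xi>"] \<xi>_in_A[OF shortest n_pos]
  unfolding vertex_time_bounce
  by (simp add: route_def bounce_def fold_plane_to_cell fold_plane_square A_in_square)

lemma continuous_on_route: "continuous_on S route"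
  unfolding route_def
  by (rule continuous_on_compose2[OF continuous_on_fold_plane[of UNIV] continuous_on_polyline]) auto

lemma route_trajectory:
  "square_trajectory A (route_length \<sigma> n \<xi>) route"
  "has_type A (route_length \<sigma> n \<xi>) route (map (zigzag \<sigma>) [0..<Suc n])"
proof -
  note facts = shortest n_pos
  have A_inside: "\<bar>Re w\<bar> < 1/2 \<and> \<bar>Im w\<bar> < 1/2" if "w \<in> A" for w
    using A_coords[OF that] \<rho>_bound by auto
  have route: "route = (\<lambda>t. fold_plane (polyline (bounce \<sigma> \<xi>) n t))"
    by (simp add: fun_eq_iff route_def)
  show "square_trajectory A (route_length \<sigma> n \<xi>) route"
    unfolding route by (rule fold_plane_trajectory(1)[OF compact_A A_inside route_plane_trajectory(1)])
  have unfolding_route: "unfolding_of A (route_length \<sigma> n \<xi>) route (polyline (bounce \<sigma> \<xi>) n)"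
    unfolding route by (rule fold_plane_trajectory(2)[OF compact_A A_inside route_plane_trajectory(1)])
  let ?ks = "map (zigzag \<sigma>) [0..<Suc n]" and ?G = "polyline (bounce \<sigma> \<xi>) n"
  have nth: "?ks ! i = zigzag \<sigma> i" if "i \<le> n" for i
    using that nth_map_upt[of i "Suc n" 0 "zigzag \<sigma>"] by simp
  have len: "length ?ks - 1 = n"
    by simp
  have "\<forall>i\<le>n. ?G (vertex_time (bounce \<sigma> \<xi>) i) \<in> frontier (obstacle_copy A (?ks ! i))"
  proof (intro allI impI)
    fix i assume i: "i \<le> n"
    show "?G (vertex_time (bounce \<sigma> \<xi>) i) \<in> frontier (obstacle_copy A (?ks ! i))"
      using \<xi>_frontier(1)[OF facts i]
      unfolding nth[OF i] frontier_obstacle_copy[OF compact_A] polyline_at_vertex[OF i n_pos]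
      by (simp add: bounce_def)
  qed
  then have "\<exists>\<Gamma> \<tau>. unfolding_of A (route_length \<sigma> n \<xi>) route \<Gamma> \<and> \<tau> 0 = 0 \<and> \<tau> n = route_length \<sigma> n \<xi> \<and>
      strict_mono_on {0..n} \<tau> \<and> (\<forall>i\<le>n. \<Gamma> (\<tau> i) \<in> frontier (obstacle_copy A (?ks ! i))) \<and>
      {t \<in> {0<..<route_length \<sigma> n \<xi>}. reflects_at \<Gamma> t} = \<tau> ` {0<..<n}"
    using unfolding_route route_plane_trajectory(2,3)
    by (intro exI[of _ ?G] exI[of _ "vertex_time (bounce \<sigma> \<xi>)"] conjI)
       (simp_all only: vertex_time_0 vertex_time_bounce)
  moreover have "?ks ! 0 = (0, 0)" "?ks \<noteq> []"
    using nth[of 0] by (simp_all add: zigzag_def del: upt_Suc)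
  moreover have "route 0 \<in> frontier A" "route (route_length \<sigma> n \<xi>) \<in> frontier A"
    using route_at_bounce[of 0] route_at_bounce[of n] \<xi>_frontier(1)[OF facts]
    by (simp_all add: route_length_def)
  ultimately show "has_type A (route_length \<sigma> n \<xi>) route ?ks"
    unfolding has_type_def Let_def len by blast
qed

end

end

section \<open>The angle along one hop\<close>

text \<open>An intermediate value argument: a continuous angle that never has distance \<open>\<kappa>\<close>
  from its reference stays within \<open>\<kappa>\<close> of it.\<close>

lemma stays_within:
  fixes h :: "real \<Rightarrow> real"
  assumes "continuous_on {p..q} h" "\<bar>h p\<bar> < \<kappa>" "\<And>t. t \<in> {p..q} \<Longrightarrow> \<bar>h t\<bar> \<noteq> \<kappa>" "t \<in> {p..q}"
  shows "\<bar>h t\<bar> < \<kappa>"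
proof (rule ccontr)
  assume "\<not> \<bar>h t\<bar> < \<kappa>"
  moreover have "continuous_on {p..t} (\<lambda>s. \<bar>h s\<bar>)"
    using assms(1,4) by (intro continuous_intros continuous_on_subset[OF assms(1)]) auto
  ultimately obtain s where "p \<le> s" "s \<le> t" "\<bar>h s\<bar> = \<kappa>"
    using IVT'[of "\<lambda>s. \<bar>h s\<bar>" p \<kappa> t] assms(2,4) by auto
  then show False
    using assms(3)[of s] assms(4) by auto
qed

lemma is_Arg_coords:
  assumes "is_Arg w \<beta>"
  shows "Re w = norm w * cos \<beta>" "Im w = norm w * sin \<beta>"
proof -
  have "w = of_real (norm w) * cis \<beta>"
    using assms by (simp add: is_Arg_def cis_conv_exp mult.commute)
  from arg_cong[OF this, of Re] arg_cong[OF this, of Im]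
  show "Re w = norm w * cos \<beta>" "Im w = norm w * sin \<beta>" by simp_all
qed

lemma is_Arg_slit:
  assumes "is_Arg w \<beta>" "w \<notin> \<real>\<^sub>\<le>\<^sub>0"
  shows "\<bar>\<beta> - 2 * pi * of_int k\<bar> \<noteq> pi"
proof
  assume *: "\<bar>\<beta> - 2 * pi * of_int k\<bar> = pi"
  have "cos \<beta> = cos (\<beta> - 2 * pi * of_int k)" "sin \<beta> = sin (\<beta> - 2 * pi * of_int k)"
    by (simp_all add: cos_diff sin_diff cos_int_2pin sin_int_2pin)
  moreover have "\<beta> - 2 * pi * of_int k = pi \<or> \<beta> - 2 * pi * of_int k = - pi"
    using * by linarith
  ultimately have "cos \<beta> = -1" "sin \<beta> = 0"
    by (metis cos_minus cos_pi, metis minus_zero sin_minus sin_pi)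
  then have "w = of_real (- norm w)"
    using is_Arg_coords[OF assms(1)] by (simp add: complex_eq_iff)
  then have "w \<in> \<real>\<^sub>\<le>\<^sub>0"
    by (metis nonpos_Reals_of_real_iff neg_le_0_iff_le norm_ge_zero)
  then show False
    using assms(2) by contradiction
qed

text \<open>Leaving the branch would mean taking an odd multiple of \<open>\<pi>\<close> as argument, which puts the
  point on the negative real axis.\<close>

lemma slit_lift:
  fixes \<beta> :: "real \<Rightarrow> real"
  assumes "continuous_on {p..q} \<beta>" "\<And>t. t \<in> {p..q} \<Longrightarrow> is_Arg (g t) (\<beta> t) \<and> g t \<notin> \<real>\<^sub>\<le>\<^sub>0"
    "\<bar>\<beta> p - 2 * pi * of_int k\<bar> < pi" "t \<in> {p..q}"
  shows "\<bar>\<beta> t - 2 * pi * of_int k\<bar> < pi"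
proof (rule stays_within[where h = "\<lambda>t. \<beta> t - 2 * pi * of_int k", OF _ assms(3) _ assms(4)])
  show "continuous_on {p..q} (\<lambda>t. \<beta> t - 2 * pi * of_int k)"
    by (intro continuous_intros assms(1))
  show "\<bar>\<beta> t - 2 * pi * of_int k\<bar> \<noteq> pi" if "t \<in> {p..q}" for t
    using is_Arg_slit[of "g t" "\<beta> t" k] assms(2)[OF that] by blast
qed

lemma is_Arg_half_plane:
  assumes "is_Arg w \<beta>" "0 < Re w * cos \<alpha> + Im w * sin \<alpha>"
  shows "0 < cos (\<beta> - \<alpha>)"
proof -
  have "Re w * cos \<alpha> + Im w * sin \<alpha> = norm w * cos (\<beta> - \<alpha>)"
    unfolding is_Arg_coords[OF assms(1)] by (simp add: cos_diff algebra_simps)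
  then show ?thesis
    using assms(2) by (metis mult_nonneg_nonpos norm_ge_zero not_less)
qed

lemma cos_pos_small:
  fixes x :: real
  assumes "0 < cos x" "\<bar>x\<bar> < 3 * pi / 2"
  shows "\<bar>x\<bar> < pi / 2"
proof (rule ccontr)
  assume "\<not> \<bar>x\<bar> < pi / 2"
  then have "0 \<le> cos (\<bar>x\<bar> - pi)"
    using assms(2) by (intro cos_ge_zero) auto
  then show False
    using assms(1) by simp
qed

lemma sin_half_pi_ge:
  assumes "0 \<le> x" "x \<le> (1::real)"
  shows "x \<le> sin (pi / 2 * x)"
proof -
  have "convex_on {0..pi/2} (\<lambda>x. - sin x)"
  proof (rule convex_on_realI[where f' = "\<lambda>x. - cos x"])
    show "((\<lambda>x. - sin x) has_real_derivative - cos x) (at x)" for x :: real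
      by (auto intro!: derivative_eq_intros)
    show "- cos x \<le> - cos y" if "x \<in> {0..pi/2}" "y \<in> {0..pi/2}" "x \<le> y" for x y
      using that by (simp add: cos_monotone_0_pi_le)
  qed simp
  from convex_onD[OF this assms, of 0 "pi/2"] show ?thesis
    by (simp add: mult.commute)
qed

lemma cos_half_pi_ge:
  assumes "\<bar>x\<bar> \<le> (1::real)"
  shows "1 - \<bar>x\<bar> \<le> cos (pi / 2 * x)"
proof -
  have "1 - \<bar>x\<bar> \<le> sin (pi / 2 * (1 - \<bar>x\<bar>))"
    using assms by (intro sin_half_pi_ge) auto
  also have "pi / 2 * (1 - \<bar>x\<bar>) = pi / 2 - pi / 2 * \<bar>x\<bar>"
    by (simp add: field_simps)
  also have "sin (pi / 2 - pi / 2 * \<bar>x\<bar>) = cos (pi / 2 * \<bar>x\<bar>)"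
    by (simp add: cos_sin_eq)
  also have "\<dots> = cos (pi / 2 * x)"
    by (cases "x \<ge> 0") auto
  finally show ?thesis .
qed

lemma sin_half_pi_mult_ge:
  assumes "\<bar>x\<bar> \<le> (1::real)"
  shows "x\<^sup>2 \<le> x * sin (pi / 2 * x)"
proof (cases "x \<ge> 0")
  case True
  then show ?thesis
    using sin_half_pi_ge[of x] assms mult_left_mono[of x _ x] by (simp add: power2_eq_square)
next
  case False
  then show ?thesis
    using sin_half_pi_ge[of "- x"] assms mult_left_mono[of "- x" "sin (pi / 2 * (- x))" "- x"]
    by (simp add: power2_eq_square)
qed

text \<open>The bounds \<open>cos (\<pi>/2 u) \<ge> 1 - \<bar>u\<bar>\<close> and
  \<open>u sin (\<pi>/2 u) \<ge> u^2\<close> leave a quadratic polynomial in \<open>u\<close> with minimum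
  \<open>c - c^2/4\<close>. The factor \<open>sqrt 2 / 2\<close> comes from the diagonal direction of the
  strip in \<open>tri_rotates\<close>.\<close>

lemma turning_half_plane:
  fixes u w c :: real
  assumes "\<bar>u\<bar> \<le> 1" "c \<le> w" "0 \<le> c" "c \<le> 1"
  shows "c / 2 \<le> (w * cos (pi / 2 * u) + u * sin (pi / 2 * u)) * (sqrt 2 / 2)"
proof -
  have "0 \<le> cos (pi / 2 * u)"
    using cos_half_pi_ge[OF assms(1)] assms(1) by linarith
  have "3 / 4 * c \<le> c - c\<^sup>2 / 4"
    using assms(3,4) mult_left_mono[of c 1 c] by (simp add: power2_eq_square)
  also have "\<dots> = c - c * \<bar>u\<bar> + u\<^sup>2 - (\<bar>u\<bar> - c / 2)\<^sup>2"
    by (simp add: power2_diff power_divide algebra_simps)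
  also have "\<dots> \<le> c * (1 - \<bar>u\<bar>) + u\<^sup>2"
    by (simp add: algebra_simps)
  also have "\<dots> \<le> w * cos (pi / 2 * u) + u * sin (pi / 2 * u)"
    using cos_half_pi_ge[OF assms(1)] sin_half_pi_mult_ge[OF assms(1)] assms \<open>0 \<le> cos (pi / 2 * u)\<close>
    by (intro add_mono mult_mono) auto
  finally have "3 / 4 * c * (2 / 3) \<le> (w * cos (pi / 2 * u) + u * sin (pi / 2 * u)) * (sqrt 2 / 2)"
    using assms(3) real_le_rsqrt[of "4/3" 2]
    by (intro mult_mono) (auto simp: power2_eq_square)
  then show ?thesis by simp
qed

lemma cos_pi_int_add: "cos (pi * of_int p + x) = (-1) powi p * cos x"
  and sin_pi_int_add: "sin (pi * of_int p + x) = (-1) powi p * sin x"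
  by (simp_all add: cos_add sin_add powi_minus_one)

text \<open>The key to counting turns. In the strip between the diagonals through \<open>(k, k)\<close> and
  through \<open>(k + 1, k)\<close>, the argument of the folded point follows the linear function
  \<open>\<alpha>\<close> with error below \<open>\<pi>/2\<close>: the folded point has a positive component
  in direction \<open>\<alpha>\<close>. The strip passes through the cells \<open>(k, k)\<close> and
  \<open>(k + 1, k)\<close> in turn; in each of them \<open>\<alpha>\<close> equals a multiple of
  \<open>\<pi>\<close> plus \<open>\<pi>/2 * u\<close> minus or plus \<open>\<pi>/4\<close>, where \<open>u\<close>
  is the sum of the coordinates relative to the centre of the cell.\<close>

lemma tri_rotates:
  fixes X Y c :: real
  assumes "0 < c" "c \<le> X - Y" "X - Y \<le> 1 - c"
  defines "\<alpha> \<equiv> pi / 2 * (X + Y) - pi / 4"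
  shows "c / 2 \<le> tri X * cos \<alpha> + tri Y * sin \<alpha>"
proof -
  define p q dx dy where "p = round X" "q = round Y" "dx = X - of_int p" "dy = Y - of_int q"
  note defs = this
  define u C S where "u = dx + dy" "C = cos (pi / 2 * u)" "S = sin (pi / 2 * u)"
  note defs2 = this
  have bounds: "\<bar>dx\<bar> \<le> 1/2" "\<bar>dy\<bar> \<le> 1/2"
    using abs_minus_round_le[of X] abs_minus_round_le[of Y] by (simp_all add: defs)
  then have u: "\<bar>u\<bar> \<le> 1"
    unfolding defs2 by linarith
  have triX: "tri X = (-1) powi p * dx" and triY: "tri Y = (-1) powi q * dy"
    by (simp_all add: tri_def defs)
  have s: "cos (pi/4) = sqrt 2 / 2" "sin (pi/4) = sqrt 2 / (2::real)"
    by (simp_all add: cos_45 sin_45)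
  have plus: "cos (pi / 2 * u + pi / 4) = (C - S) * (sqrt 2 / 2)"
      "sin (pi / 2 * u + pi / 4) = (S + C) * (sqrt 2 / 2)"
    by (simp_all add: cos_add sin_add s defs2 algebra_simps)
  have minus: "cos (pi / 2 * u - pi / 4) = (C + S) * (sqrt 2 / 2)"
      "sin (pi / 2 * u - pi / 4) = (S - C) * (sqrt 2 / 2)"
    by (simp_all add: cos_diff sin_diff s defs2 algebra_simps)
  have XY: "X = of_int p + dx" "Y = of_int q + dy"
    by (simp_all add: defs)
  have "real_of_int p - of_int q < 2" "- 1 < real_of_int p - of_int q"
    using assms(1-3) bounds unfolding XY by linarith+
  then have "p = q \<or> p = q + 1"
    by linarith
  then show ?thesis
  proof
    assume "p = q"
    have "\<alpha> = pi * of_int q + (pi / 2 * u - pi / 4)"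
      unfolding \<alpha>_def XY \<open>p = q\<close> defs2 by (simp add: algebra_simps)
    then have "tri X * cos \<alpha> + tri Y * sin \<alpha>
        = dx * cos (pi / 2 * u - pi / 4) + dy * sin (pi / 2 * u - pi / 4)"
      unfolding triX triY \<open>p = q\<close> by (simp only: cos_pi_int_add sin_pi_int_add) (simp add: powi_minus_one)
    also have "\<dots> = ((X - Y) * C + u * S) * (sqrt 2 / 2)"
    proof -
      have "X - Y = dx - dy" "u = dx + dy"
        unfolding XY \<open>p = q\<close> by (simp_all add: defs2)
      note eq = this
      show ?thesis
        unfolding minus by (subst eq(1), subst eq(2)) (simp add: field_simps)
    qed
    also have "\<dots> \<ge> c / 2"
      using turning_half_plane[OF u, of c "X - Y"] assms(1-3) unfolding defs2(2,3) by simp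
    finally show ?thesis .
  next
    assume "p = q + 1"
    have "\<alpha> = pi * of_int q + (pi / 2 * u + pi / 4)"
      unfolding \<alpha>_def XY \<open>p = q + 1\<close> defs2 by (simp add: algebra_simps)
    then have "tri X * cos \<alpha> + tri Y * sin \<alpha>
        = - dx * cos (pi / 2 * u + pi / 4) + dy * sin (pi / 2 * u + pi / 4)"
      unfolding triX triY \<open>p = q + 1\<close> by (simp only: cos_pi_int_add sin_pi_int_add) (simp add: powi_minus_one)
    also have "\<dots> = ((1 - (X - Y)) * C + u * S) * (sqrt 2 / 2)"
    proof -
      have "1 - (X - Y) = dy - dx" "u = dx + dy"
        unfolding XY \<open>p = q + 1\<close> by (simp_all add: defs2)
      note eq = this
      show ?thesis
        unfolding plus by (subst eq(1), subst eq(2)) (simp add: field_simps)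
    qed
    also have "\<dots> \<ge> c / 2"
      using turning_half_plane[OF u, of c "1 - (X - Y)"] assms(1-3) unfolding defs2(2,3) by simp
    finally show ?thesis .
  qed
qed

context tiny_obstacle
begin

text \<open>Multiplying the second coordinate by \<open>s\<close> treats upward and downward hops together.\<close>

lemma hop_coords:
  fixes s :: int
  assumes "a \<in> A" "b \<in> A" "\<bar>s\<bar> = 1"
  shows "Re (hop s a b) = real N + 1 - Re a - Re b"
    and "of_int s * Im (hop s a b) = real N + of_int s * Im b - of_int s * Im a"
    and "\<bar>of_int s * Im a\<bar> \<le> \<rho>" "\<bar>of_int s * Im b\<bar> \<le> \<rho>"
proof -
  have "s = 1 \<or> s = -1"
    using assms(3) by linarith
  then show "Re (hop s a b) = real N + 1 - Re a - Re b"
    and "of_int s * Im (hop s a b) = real N + of_int s * Im b - of_int s * Im a"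
    and "\<bar>of_int s * Im a\<bar> \<le> \<rho>" "\<bar>of_int s * Im b\<bar> \<le> \<rho>"
    using A_coords[OF assms(1)] A_coords[OF assms(2)] by (auto simp: hop_def)
qed

text \<open>A hop leaves its first cell through a vertical side: it reaches the line \<open>x = 1/2\<close> before
  the second coordinate exceeds \<open>1/2\<close>, because a hop rises a little less steeply than a diagonal
  and the obstacle is small compared with this difference.\<close>

lemma near_start_in_square:
  assumes "a \<in> A" "b \<in> A" "\<bar>s\<bar> = 1" "0 \<le> l" "l * Re (hop s a b) \<le> 1/2 - Re a"
  shows "a + of_real l * hop s a b \<in> unit_square"
proof -
  define D E where "D = Re (hop s a b)" "E = of_int s * Im (hop s a b)"
  note defs = this
  note small = A_coords[OF assms(1)] A_coords[OF assms(2)] \<rho>_bound \<rho>_nonneg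
  note co = hop_coords[OF assms(1-3), folded defs]
  have N: "1 \<le> real N"
    using N_pos by simp
  have "0 \<le> l * D"
    using assms(4) small co(1) N by (intro mult_nonneg_nonneg) auto
  have "0 \<le> l * E"
    using assms(4) small co N by (intro mult_nonneg_nonneg) auto
  have "16 * \<rho> * D \<le> 16 * \<rho> * (real N + 2)"
    using small co(1) by (intro mult_left_mono) auto
  also have "\<dots> < 1"
    using \<rho>_small by (simp add: ac_simps)
  finally have "16 * \<rho> * D < 1" .
  have "D - E = 1 - Re a - Re b - of_int s * Im b + of_int s * Im a"
    using co(1,2) by linarith
  then have "1/2 \<le> D - E"
    using co(3,4) small by linarith
  then have "8 * \<rho> * D \<le> D - E"
    using \<open>16 * \<rho> * D < 1\<close> by linarith
  then have "l * E \<le> l * (D * (1 - 8 * \<rho>))"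
    using assms(4) by (intro mult_left_mono) (auto simp: algebra_simps)
  also have "\<dots> = (l * D) * (1 - 8 * \<rho>)"
    by simp
  also have "\<dots> \<le> (1/2 + \<rho>) * (1 - 8 * \<rho>)"
    using assms(5) small unfolding defs(1)[symmetric] by (intro mult_right_mono) auto
  also have "\<dots> = 1/2 - 3 * \<rho> - 8 * \<rho>\<^sup>2"
    by (simp add: algebra_simps power2_eq_square)
  also have "\<dots> \<le> 1/2 - \<rho>"
    using small zero_le_power2[of \<rho>] by linarith
  finally have "\<bar>of_int s * Im a + l * E\<bar> \<le> 1/2"
    using \<open>0 \<le> l * E\<close> co(3) small by linarith
  moreover have "of_int s * Im a + l * E = of_int s * Im (a + of_real l * hop s a b)"
    by (simp add: defs algebra_simps)
  moreover have "\<bar>real_of_int s\<bar> = 1"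
    using assms(3) by linarith
  ultimately have "\<bar>Im (a + of_real l * hop s a b)\<bar> \<le> 1/2"
    by (simp only: abs_mult mult_1)
  moreover have "\<bar>Re a + l * D\<bar> \<le> 1/2"
    using \<open>0 \<le> l * D\<close> assms(5)[folded defs] small by linarith
  then have "\<bar>Re (a + of_real l * hop s a b)\<bar> \<le> 1/2"
    by (simp add: defs)
  ultimately show ?thesis
    by (simp add: unit_square_def)
qed

lemma hop_reverse: "hop (- s) b a = cnj (hop s a b)"
  by (simp add: hop_def complex_eq_iff)

lemma hop_end: "a + of_real l * hop s a b = Complex (real N + 1) (of_int s * real N) - cnj (b + of_real (1 - l) * cnj (hop s a b))"
  by (simp add: hop_def complex_eq_iff algebra_simps)

text \<open>Run backwards from its end, a hop is again a hop, up to a symmetry of the folding.\<close>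

lemma fold_plane_hop_end:
  "fold_plane (a + of_real l * hop s a b) = fold_plane (b + of_real (1 - l) * cnj (hop s a b))"
proof -
  have tri: "tri (real N + 1 - x) = tri x" "tri (of_int s * real N + x) = tri x" for x
    using tri_odd_minus[of "int N + 1" x] tri_plus_even[of "s * int N" x] even_N by simp_all
  define v w where "v = a + of_real l * hop s a b" "w = b + of_real (1 - l) * cnj (hop s a b)"
  note vw = this
  have "Re v = real N + 1 - Re w" "Im v = of_int s * real N + Im w"
    unfolding vw by (simp_all add: hop_def algebra_simps)
  then have "fold_plane v = fold_plane w"
    by (simp add: complex_eq_iff tri)
  then show ?thesis
    unfolding vw .
qed

text \<open>Between the lines \<open>x = 1/2\<close> and \<open>x = N + 1/2\<close> a hop stays inside the strip of
  \<open>tri_rotates\<close> with the margin \<open>c = 1 / (8 (N + 2))\<close>. This margin exceeds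
  \<open>2 * \<rho>\<close>, so the half-plane estimate holds about \<open>z\<close> as well as about the
  origin.\<close>

lemma fold_plane_middle:
  assumes "a \<in> A" "b \<in> A" "z \<in> A" "\<bar>s\<bar> = 1" and l: "0 \<le> l" "l \<le> 1"
    and lo: "1/2 - Re a \<le> l * Re (hop s a b)" and hi: "1/2 - Re b \<le> (1 - l) * Re (hop s a b)"
    and p: "p = a + of_real l * hop s a b"
  defines "\<alpha> \<equiv> of_int s * (pi / 2 * (Re p + of_int s * Im p) - pi / 4)"
  shows "0 < Re (fold_plane p - z) * cos \<alpha> + Im (fold_plane p - z) * sin \<alpha>"
proof -
  define c where "c = 1 / (8 * (real N + 2))"
  define D E where "D = Re (hop s a b)" "E = of_int s * Im (hop s a b)"
  note defs = this
  note small = A_coords[OF assms(1)] A_coords[OF assms(2)] \<rho>_bound \<rho>_nonneg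
  note co = hop_coords[OF assms(1,2,4), folded defs]
  have "0 < c" and c: "2 * \<rho> < c"
    using \<rho>_small by (simp_all add: c_def field_simps)
  have D: "0 < D" "D \<le> real N + 2"
    using co(1) small by auto
  have 2: "2 * c \<le> m" if "1/4 \<le> m * D" "0 \<le> m" for m
  proof -
    have "m * D \<le> m * (real N + 2)"
      using D that(2) by (intro mult_left_mono) auto
    then show ?thesis
      using that(1) by (simp add: c_def field_simps)
  qed
  have l2: "2 * c \<le> l" "2 * c \<le> 1 - l"
    using 2[of l] 2[of "1 - l"] l lo hi small unfolding defs(1)[symmetric] by linarith+
  \<comment> \<open>the position across the strip grows from about \<open>0\<close> to about \<open>1\<close> along the hop\<close>
  define g where "g = Re p - of_int s * Im p"
  have "g - l = (1 - l) * (Re a - of_int s * Im a) + l * (- Re b - of_int s * Im b)"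
  proof -
    have "D - E = 1 - Re a - Re b - of_int s * Im b + of_int s * Im a"
      using co(1,2) by linarith
    moreover have "g = Re a - of_int s * Im a + l * (D - E)"
      unfolding g_def p defs by (simp add: algebra_simps)
    ultimately show ?thesis
      by (simp only:) (simp add: algebra_simps)
  qed
  moreover have "\<bar>(1 - l) * (Re a - of_int s * Im a)\<bar> \<le> (1 - l) * (2 * \<rho>)"
      "\<bar>l * (- Re b - of_int s * Im b)\<bar> \<le> l * (2 * \<rho>)"
    unfolding abs_mult using l co small by (intro mult_mono; linarith)+
  moreover have "(1 - l) * (2 * \<rho>) + l * (2 * \<rho>) = 2 * \<rho>"
    by (simp add: algebra_simps)
  ultimately have "\<bar>g - l\<bar> \<le> 2 * \<rho>"
    by linarith
  then have "c \<le> g" "g \<le> 1 - c"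
    using c l2 by linarith+
  then have "c / 2 \<le> tri (Re p) * cos (of_int s * \<alpha>) + tri (of_int s * Im p) * sin (of_int s * \<alpha>)"
  proof -
    have "of_int s * \<alpha> = pi / 2 * (Re p + of_int s * Im p) - pi / 4"
      using assms(4) by (auto simp: \<alpha>_def abs_if split: if_splits)
    then show ?thesis
      using tri_rotates[OF \<open>0 < c\<close>, of "Re p" "of_int s * Im p"] \<open>c \<le> g\<close> \<open>g \<le> 1 - c\<close>
      by (simp add: g_def)
  qed
  also have "\<dots> = tri (Re p) * cos \<alpha> + tri (Im p) * sin \<alpha>"
  proof -
    have "s = 1 \<or> s = -1" using assms(4) by linarith
    then show ?thesis by (auto simp: tri_minus)
  qed
  finally have "c / 2 \<le> tri (Re p) * cos \<alpha> + tri (Im p) * sin \<alpha>" .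
  moreover have "Re z * cos \<alpha> + Im z * sin \<alpha> \<le> \<rho>"
  proof -
    have "Re z * cos \<alpha> + Im z * sin \<alpha> = inner z (cis \<alpha>)"
      by (simp add: inner_complex_def)
    also have "\<dots> \<le> norm z * norm (cis \<alpha>)"
      by (rule norm_cauchy_schwarz)
    finally show ?thesis
      using A_norm[OF assms(3)] by simp
  qed
  ultimately show ?thesis
    using c by (simp add: left_diff_distrib)
qed

text \<open>One hop makes \<open>s * N / 2\<close> turns. In the first and the last cell the argument keeps its
  branch on the slit plane. In between it follows the linear function \<open>\<alpha>\<close>, which is within
  \<open>\<pi>/4\<close> of \<open>0\<close> at the beginning and within \<open>\<pi>/4\<close> of
  \<open>s * N * \<pi>\<close> at the end.\<close>

lemma hop_winding:
  assumes A: "a \<in> A" "b \<in> A" "z \<in> A" "\<bar>s\<bar> = 1"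
    and cont: "continuous_on {0..1} \<beta>"
    and arg: "\<And>l. l \<in> {0..1} \<Longrightarrow> is_Arg (fold_plane (a + of_real l * hop s a b) - z) (\<beta> l)"
    and slit_a: "\<And>l. l \<in> {0..1} \<Longrightarrow> a + of_real l * hop s a b - z \<notin> \<real>\<^sub>\<le>\<^sub>0"
    and slit_b: "\<And>l. l \<in> {0..1} \<Longrightarrow> b + of_real l * cnj (hop s a b) - z \<notin> \<real>\<^sub>\<le>\<^sub>0"
    and start: "\<bar>\<beta> 0 - 2 * pi * of_int k\<bar> < pi"
  shows "\<bar>\<beta> 1 - 2 * pi * of_int (k + s * int (N div 2))\<bar> < pi"
proof -
  define D where "D = Re (hop s a b)"
  \<comment> \<open>the fractions of the hop that lie in its first and in its last cell\<close>
  define m n where "m = (1/2 - Re a) / D" "n = (1/2 - Re b) / D"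
  note mn = this
  note small = A_coords[OF A(1)] A_coords[OF A(2)] \<rho>_bound \<rho>_nonneg
  have N2: "2 * real (N div 2) = real N"
    using even_N by (auto elim!: evenE)
  have "2 \<le> N"
    using even_N N_pos by presburger
  then have D: "2 < D"
    using hop_coords(1)[OF A(1,2,4)] small by (simp add: D_def)
  have m: "0 < m" "m < 1/2" "m * D = 1/2 - Re a" and n: "0 < n" "n < 1/2" "n * D = 1/2 - Re b"
    using D small by (auto simp: mn field_simps)
  define p where "p l = a + of_real l * hop s a b" for l
  define \<alpha> where "\<alpha> l = of_int s * (pi / 2 * (Re (p l) + of_int s * Im (p l)) - pi / 4)" for l
  have s: "s = 1 \<or> s = -1" "real_of_int s = 1 \<or> real_of_int s = -1"
    using A(4) by linarith+
  then have s_abs: "\<bar>real_of_int s\<bar> = 1"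
    by auto
  have p_start: "p l \<in> unit_square" if "l \<in> {0..m}" for l
  proof -
    have "l * D \<le> m * D"
      using that D by (intro mult_right_mono) auto
    then show ?thesis
      unfolding p_def using that m(3) near_start_in_square[OF A(1,2,4), of l] by (simp add: D_def)
  qed
  have q_start: "b + of_real l * cnj (hop s a b) \<in> unit_square" if "l \<in> {0..n}" for l
  proof -
    have "l * D \<le> n * D"
      using that D by (intro mult_right_mono) auto
    then show ?thesis
      using that n(3) near_start_in_square[OF A(2,1), of "- s" l] A(4) by (simp add: D_def hop_reverse)
  qed
  define B where "B l = \<beta> l - 2 * pi * of_int k" for l
  have "\<bar>B m\<bar> < pi"
    unfolding B_def
  proof (rule slit_lift[of 0 m \<beta> "\<lambda>l. p l - z"])
    fix l assume "l \<in> {0..m}"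
    then have "l \<in> {0..1}" "fold_plane (p l) = p l"
      using m fold_plane_square[OF p_start] by auto
    then show "is_Arg (p l - z) (\<beta> l) \<and> p l - z \<notin> \<real>\<^sub>\<le>\<^sub>0"
      using arg[of l] slit_a[of l] unfolding p_def by simp
  qed (use m start in \<open>auto intro: continuous_on_subset[OF cont]\<close>)
  moreover have "\<bar>\<alpha> m\<bar> \<le> pi / 4"
  proof -
    have "\<bar>of_int s * Im (p m)\<bar> = \<bar>Im (p m)\<bar>"
      using s(2) by (auto simp: abs_mult)
    then have "\<bar>of_int s * Im (p m)\<bar> \<le> 1/2"
      using m p_start[of m] by (simp add: unit_square_def)
    have "Re (p m) = 1/2"
      using m by (simp add: p_def D_def)
    then have "\<alpha> m = of_int s * (pi / 2 * (of_int s * Im (p m)))"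
      unfolding \<alpha>_def by (simp only:) (simp add: field_simps)
    then have "\<bar>\<alpha> m\<bar> = pi / 2 * \<bar>of_int s * Im (p m)\<bar>"
      by (simp only: abs_mult s_abs) simp
    also have "\<dots> \<le> pi / 2 * (1/2)"
      using \<open>\<bar>of_int s * Im (p m)\<bar> \<le> 1/2\<close> by (intro mult_left_mono) auto
    finally show ?thesis by simp
  qed
  ultimately have start_lt: "\<bar>B m - \<alpha> m\<bar> < 3 * pi / 2"
    using pi_gt_zero by linarith
  have cos_pos: "0 < cos (B l - \<alpha> l)" if "l \<in> {m..1 - n}" for l
  proof -
    have "m * D \<le> l * D" "n * D \<le> (1 - l) * D"
      using that D by (intro mult_right_mono; auto)+
    then have "0 < Re (fold_plane (p l) - z) * cos (\<alpha> l) + Im (fold_plane (p l) - z) * sin (\<alpha> l)"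
      unfolding \<alpha>_def
      by (intro fold_plane_middle[OF A, of l "p l"]) (use that m n in \<open>auto simp: p_def D_def\<close>)
    moreover have "is_Arg (fold_plane (p l) - z) (\<beta> l)"
      unfolding p_def using that m n by (intro arg) auto
    ultimately have "0 < cos (\<beta> l - \<alpha> l)"
      by (intro is_Arg_half_plane)
    also have "\<dots> = cos ((\<beta> l - \<alpha> l) - 2 * pi * of_int k)"
      unfolding cos_diff[of _ "2 * pi * of_int k"] by (simp add: cos_int_2pin sin_int_2pin)
    finally show ?thesis
      by (simp add: B_def algebra_simps)
  qed
  have "\<bar>B (1 - n) - \<alpha> (1 - n)\<bar> < pi / 2"
  proof (rule stays_within[of m "1 - n" "\<lambda>l. B l - \<alpha> l"])
    show "continuous_on {m..1 - n} (\<lambda>l. B l - \<alpha> l)"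
      unfolding B_def \<alpha>_def p_def using m n
      by (intro continuous_intros continuous_on_subset[OF cont]) auto
    show "\<bar>B m - \<alpha> m\<bar> < pi / 2"
      using cos_pos[of m] start_lt m n
      by (intro cos_pos_small) auto
    show "\<bar>B l - \<alpha> l\<bar> \<noteq> pi / 2" if "l \<in> {m..1 - n}" for l
    proof
      assume "\<bar>B l - \<alpha> l\<bar> = pi / 2"
      then have "cos \<bar>B l - \<alpha> l\<bar> = cos (pi / 2)"
        by (rule arg_cong)
      then show False
        using cos_pos[OF that] unfolding cos_abs_real cos_pi_half by simp
    qed
  qed (use m n in auto)
  moreover have "\<bar>\<alpha> (1 - n) - of_int s * real N * pi\<bar> \<le> pi / 4"
  proof -
    have q: "p (1 - n) = Complex (real N + 1) (of_int s * real N) - cnj (b + of_real n * cnj (hop s a b))"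
      unfolding p_def hop_end by simp
    define y where "y = Im (b + of_real n * cnj (hop s a b))"
    have "\<bar>of_int s * y\<bar> = \<bar>y\<bar>"
      using s(2) by (auto simp only: abs_mult abs_one abs_minus_cancel mult_1)
    then have "\<bar>of_int s * y\<bar> \<le> 1/2"
      using n q_start[of n] unfolding y_def by (simp add: unit_square_def)
    have "Re (b + of_real n * cnj (hop s a b)) = 1/2"
      using n by (simp add: D_def)
    then have eq: "Re (p (1 - n)) = real N + 1/2" "of_int s * Im (p (1 - n)) = real N + of_int s * y"
      unfolding q y_def using s(2) by auto
    have "\<alpha> (1 - n) - of_int s * real N * pi = of_int s * (pi / 2 * (of_int s * y))"
      unfolding \<alpha>_def eq by (simp add: field_simps)
    moreover have "\<bar>of_int s * (pi / 2 * (of_int s * y))\<bar> = pi / 2 * \<bar>of_int s * y\<bar>"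
      by (simp only: abs_mult s_abs) simp
    moreover have "pi / 2 * \<bar>of_int s * y\<bar> \<le> pi / 2 * (1/2)"
      using \<open>\<bar>of_int s * y\<bar> \<le> 1/2\<close> by (intro mult_left_mono) auto
    ultimately show ?thesis by (simp only:)
  qed
  moreover have "\<beta> (1 - n) - 2 * pi * of_int (k + s * int (N div 2)) = B (1 - n) - of_int s * real N * pi"
    unfolding N2[symmetric] B_def by (simp add: algebra_simps)
  ultimately have "\<bar>\<beta> (1 - n) - 2 * pi * of_int (k + s * int (N div 2))\<bar> < pi"
    using pi_gt_zero by linarith
  then show ?thesis
  proof (rule slit_lift[of "1 - n" 1 \<beta> "\<lambda>l. b + of_real (1 - l) * cnj (hop s a b) - z", rotated 2])
    fix l assume l: "l \<in> {1 - n..1}"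
    then have "fold_plane (p l) = b + of_real (1 - l) * cnj (hop s a b)"
      unfolding p_def fold_plane_hop_end by (intro fold_plane_square q_start) auto
    then show "is_Arg (b + of_real (1 - l) * cnj (hop s a b) - z) (\<beta> l) \<and>
        b + of_real (1 - l) * cnj (hop s a b) - z \<notin> \<real>\<^sub>\<le>\<^sub>0"
      using arg[of l] slit_b[of "1 - l"] l n unfolding p_def by simp
  qed (use n in \<open>auto intro: continuous_on_subset[OF cont]\<close>)
qed

end

section \<open>Steering the rotation number\<close>

context tiny_obstacle
begin

text \<open>The turns of the hops add up without accumulating errors, since at each reflection the argument
  lies in a known branch over the slit plane.\<close>

lemma route_displacement:
  assumes shortest: "shortest \<sigma> n \<xi>" and n_pos: "0 < n" and signs: "\<And>i. \<bar>\<sigma> i\<bar> = 1"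
    and z: "z \<in> interior A"
  shows "\<exists>d. displacement z (route_length \<sigma> n \<xi>) (route \<sigma> n \<xi>) d \<and>
      \<bar>d - real N / 2 * of_int (\<Sum>i<n. \<sigma> i)\<bar> < 1"
proof -
  note facts = shortest n_pos
  let ?T = "route_length \<sigma> n \<xi>" and ?g = "route \<sigma> n \<xi>"
  have "z \<in> A"
    using z interior_subset by blast
  have "?g t \<noteq> z" if "t \<in> {0..?T}" for t
    using route_trajectory(1)[OF shortest n_pos signs] that z
    unfolding square_trajectory_def trajectory_def by blast
  then have nz: "?g t - z \<noteq> 0" if "t \<in> {0..?T}" for t
    using that by simp
  have cont_g: "continuous_on {0..?T} (\<lambda>t. ?g t - z)"
    by (intro continuous_intros continuous_on_route[OF shortest n_pos signs])
  have "contractible {0..?T}"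
    by (intro convex_imp_contractible) simp
  then obtain L where L: "continuous_on {0..?T} L" "\<And>t. t \<in> {0..?T} \<Longrightarrow> ?g t - z = exp (L t)"
    using continuous_logarithm_on_contractible[OF cont_g _ nz] by blast
  define \<theta> where "\<theta> t = Im (L t) / (2 * pi)" for t
  have cont: "continuous_on {0..?T} \<theta>"
    unfolding \<theta>_def by (intro continuous_intros L(1)) auto
  have arg: "is_Arg (?g t - z) (2 * pi * \<theta> t)" if "t \<in> {0..?T}" for t
    unfolding is_Arg_def L(2)[OF that] \<theta>_def
    by (simp add: exp_eq_polar[of "L t"] cis_conv_exp norm_mult)
  have R_mono: "0 \<le> route_length \<sigma> i \<xi>" "i \<le> n \<Longrightarrow> route_length \<sigma> i \<xi> \<le> ?T" for i
    unfolding route_length_def by (auto intro!: sum_nonneg sum_mono2)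
  \<comment> \<open>the branch at the start; only the increment of \<open>\<theta>\<close> matters in the end\<close>
  define k where "k = round (\<theta> 0)"
  have "?g 0 = \<xi> 0"
    using route_at_bounce[OF shortest n_pos signs, of 0] by (simp add: route_length_def)
  moreover have "\<xi> 0 - z \<notin> \<real>\<^sub>\<le>\<^sub>0"
    using away_slit[OF facts, of 0 "heading \<sigma> \<xi> 0" 0 z] n_pos z by (simp add: away_def[OF facts])
  ultimately have "\<bar>2 * pi * \<theta> 0 - 2 * pi * of_int k\<bar> \<noteq> pi"
    using is_Arg_slit[OF arg[of 0]] R_mono(2)[of 0] by (auto simp: route_length_def)
  moreover have "\<bar>2 * pi * \<theta> 0 - 2 * pi * of_int k\<bar> \<le> pi"
  proof -
    have "2 * pi * \<theta> 0 - 2 * pi * of_int k = 2 * pi * (\<theta> 0 - of_int k)"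
      by (simp add: algebra_simps)
    then have "\<bar>2 * pi * \<theta> 0 - 2 * pi * of_int k\<bar> = 2 * pi * \<bar>\<theta> 0 - of_int k\<bar>"
      by (simp only: abs_mult) simp
    also have "\<dots> \<le> 2 * pi * (1/2)"
      unfolding k_def by (intro mult_left_mono abs_minus_round_le) auto
    finally show ?thesis by simp
  qed
  ultimately have start: "\<bar>2 * pi * \<theta> 0 - 2 * pi * of_int k\<bar> < pi"
    by linarith
  have winding: "\<bar>2 * pi * \<theta> (route_length \<sigma> i \<xi>) - 2 * pi * of_int (k + (\<Sum>j<i. \<sigma> j) * int (N div 2))\<bar> < pi"
    if "i \<le> n" for i
    using that
  proof (induction i)
    case 0
    then show ?case using start by (simp add: route_length_def)
  next
    case (Suc i)
    let ?R = "route_length \<sigma> i \<xi>" and ?h = "hop (\<sigma> i) (\<xi> i) (\<xi> (Suc i))"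
    have R: "route_length \<sigma> (Suc i) \<xi> = ?R + norm ?h"
      by (simp add: route_length_def)
    have times: "?R + l * norm ?h \<in> {0..?T}" "?R + l * norm ?h \<le> route_length \<sigma> (Suc i) \<xi>"
        "?R \<le> ?R + l * norm ?h" if "l \<in> {0..1}" for l
      using that mult_right_mono[of l 1 "norm ?h"] R R_mono(1)[of i] R_mono(2)[OF Suc.prems] by auto
    have along: "(l * norm ?h) *\<^sub>R heading \<sigma> \<xi> i = of_real l * ?h"
        "(l * norm ?h) *\<^sub>R cnj (heading \<sigma> \<xi> i) = of_real l * cnj ?h" for l
    proof -
      show *: "(l * norm ?h) *\<^sub>R heading \<sigma> \<xi> i = of_real l * ?h" for l
        unfolding heading_def scaleR_scaleR[symmetric] norm_scaleR_sgn by (simp add: scaleR_conv_of_real)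
      show "(l * norm ?h) *\<^sub>R cnj (heading \<sigma> \<xi> i) = of_real l * cnj ?h"
        using arg_cong[OF *[of l], of cnj] by simp
    qed
    have "\<bar>2 * pi * \<theta> (?R + 1 * norm ?h)
        - 2 * pi * of_int ((k + (\<Sum>j<i. \<sigma> j) * int (N div 2)) + \<sigma> i * int (N div 2))\<bar> < pi"
    proof (rule hop_winding[where \<beta> = "\<lambda>l. 2 * pi * \<theta> (?R + l * norm ?h)"])
      show "\<xi> i \<in> A" "\<xi> (Suc i) \<in> A"
        using \<xi>_in_A[OF facts] by auto
      show "continuous_on {0..1} (\<lambda>l. 2 * pi * \<theta> (?R + l * norm ?h))"
        by (intro continuous_intros continuous_on_compose2[OF cont]) (use times in auto)
      show "is_Arg (fold_plane (\<xi> i + of_real l * ?h) - z) (2 * pi * \<theta> (?R + l * norm ?h))"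
        if "l \<in> {0..1}" for l
        using arg[OF times(1)[OF that]] Suc.prems
          route_on_edge[OF shortest n_pos signs, of i "?R + l * norm ?h"] times[OF that]
        by (simp add: along)
      show "\<xi> i + of_real l * ?h - z \<notin> \<real>\<^sub>\<le>\<^sub>0" if "l \<in> {0..1}" for l
        using away_slit[OF facts, of i "heading \<sigma> \<xi> i" "l * norm ?h" z] z that Suc.prems
        by (simp add: away_def[OF facts] along)
      show "\<xi> (Suc i) + of_real l * cnj ?h - z \<notin> \<real>\<^sub>\<le>\<^sub>0" if "l \<in> {0..1}" for l
        using away_slit[OF facts, of "Suc i" "cnj (heading \<sigma> \<xi> i)" "l * norm ?h" z] z that Suc.prems
        by (simp add: away_def[OF facts] along)
      show "\<bar>2 * pi * \<theta> (?R + 0 * norm ?h) - 2 * pi * of_int (k + (\<Sum>j<i. \<sigma> j) * int (N div 2))\<bar> < pi"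
        using Suc by simp
    qed (use \<open>z \<in> A\<close> signs in auto)
    then show ?case
      unfolding R by (simp add: algebra_simps)
  qed
  define d where "d = \<theta> ?T - \<theta> 0"
  have "2 * real (N div 2) = real N"
    using even_N by (auto elim!: evenE)
  then have S: "real_of_int ((\<Sum>j<n. \<sigma> j) * int (N div 2)) = real N / 2 * of_int (\<Sum>j<n. \<sigma> j)"
    by simp
  define w where "w = d - real N / 2 * of_int (\<Sum>j<n. \<sigma> j)"
  have "2 * pi * w = (2 * pi * \<theta> ?T - 2 * pi * of_int (k + (\<Sum>j<n. \<sigma> j) * int (N div 2)))
      - (2 * pi * \<theta> 0 - 2 * pi * of_int k)"
    unfolding w_def of_int_add S d_def by (simp add: algebra_simps)
  then have "\<bar>2 * pi * w\<bar> < 2 * pi"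
    using winding[of n] start by linarith
  then have "\<bar>w\<bar> < 1"
    by (simp add: abs_mult)
  moreover have "displacement z ?T ?g d"
    unfolding displacement_def d_def using cont arg by blast
  ultimately show ?thesis
    unfolding w_def by blast
qed

definition mean_hop :: real where
  "mean_hop = sqrt (2 * (real N)\<^sup>2 + 2 * real N + 1)"

lemma mean_hop_ge: "2 \<le> mean_hop"
proof -
  have "1 \<le> real N" using N_pos by simp
  then have "1 \<le> (real N)\<^sup>2" by (rule one_le_power)
  with \<open>1 \<le> real N\<close> have "4 \<le> 2 * (real N)\<^sup>2 + 2 * real N + 1"
    by linarith
  then show ?thesis
    unfolding mean_hop_def by (intro real_le_rsqrt) simp
qed

text \<open>Upper bound: extend the shorter route by an arbitrary last vertex. Lower bound: delete the last
  vertex of the longer route.\<close>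

lemma route_length_extend:
  assumes "\<And>i. \<bar>\<sigma> i\<bar> = 1" "shortest \<sigma> n \<xi>" "\<bar>s\<bar> = 1" "shortest (\<sigma>(n := s)) (Suc n) \<eta>"
  shows "\<bar>route_length (\<sigma>(n := s)) (Suc n) \<eta> - route_length \<sigma> n \<xi> - mean_hop\<bar> \<le> 2 * \<rho>"
proof -
  have upd: "route_length (\<sigma>(n := s)) (Suc n) \<zeta> = route_length \<sigma> n \<zeta> + norm (hop s (\<zeta> n) (\<zeta> (Suc n)))" for \<zeta>
    by (simp add: route_length_def)
  have "range \<xi> \<subseteq> A" "range \<eta> \<subseteq> A"
    using assms(2,4) by (auto simp: shortest_def)
  then have "route_length (\<sigma>(n := s)) (Suc n) \<eta> \<le> route_length (\<sigma>(n := s)) (Suc n) \<xi>"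
      "route_length \<sigma> n \<xi> \<le> route_length \<sigma> n \<eta>"
    using assms(2,4) by (simp_all add: shortest_def)
  moreover have "\<bar>norm (hop s (\<zeta> n) (\<zeta> (Suc n))) - mean_hop\<bar> \<le> 2 * \<rho>" if "range \<zeta> \<subseteq> A" for \<zeta>
    unfolding mean_hop_def using that assms(3) by (intro norm_hop_bounds) auto
  then have "\<bar>norm (hop s (\<xi> n) (\<xi> (Suc n))) - mean_hop\<bar> \<le> 2 * \<rho>"
      "\<bar>norm (hop s (\<eta> n) (\<eta> (Suc n))) - mean_hop\<bar> \<le> 2 * \<rho>"
    using \<open>range \<xi> \<subseteq> A\<close> \<open>range \<eta> \<subseteq> A\<close> by blast+
  ultimately show ?thesis
    unfolding upd by linarith
qed

text \<open>The next hop is upwards if the accumulated turns are behind \<open>r\<close> times the length and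
  downwards if they are ahead. As \<open>\<bar>r\<bar>\<close> times the length of a hop is at most
  \<open>N/2\<close>, the difference then moves in the right direction, and by at most \<open>N\<close>.\<close>

lemma greedy_route:
  assumes r: "\<bar>r\<bar> * (mean_hop + 2 * \<rho>) \<le> real N / 2"
  shows "\<exists>\<sigma> \<xi>. (\<forall>i. \<bar>\<sigma> i\<bar> = 1) \<and> shortest \<sigma> n \<xi> \<and> real n \<le> route_length \<sigma> n \<xi> \<and>
    \<bar>real N / 2 * of_int (\<Sum>i<n. \<sigma> i) - r * route_length \<sigma> n \<xi>\<bar> \<le> real N"
proof (induction n)
  case 0
  obtain \<xi> where "shortest (\<lambda>_. 1) 0 \<xi>"
    using exists_shortest by blast
  then show ?case
    by (intro exI[of _ "\<lambda>_. 1"] exI[of _ \<xi>]) (simp add: route_length_def)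
next
  case (Suc n)
  then obtain \<sigma> \<xi> where \<sigma>: "\<And>i. \<bar>\<sigma> i\<bar> = 1" and \<xi>: "shortest \<sigma> n \<xi>" and n: "real n \<le> route_length \<sigma> n \<xi>"
      and E: "\<bar>real N / 2 * of_int (\<Sum>i<n. \<sigma> i) - r * route_length \<sigma> n \<xi>\<bar> \<le> real N"
    by blast
  define e where "e = real N / 2 * of_int (\<Sum>i<n. \<sigma> i) - r * route_length \<sigma> n \<xi>"
  define s :: int where "s = (if e \<le> 0 then 1 else - 1)"
  define \<sigma>' where "\<sigma>' = \<sigma>(n := s)"
  obtain \<eta> where \<eta>: "shortest \<sigma>' (Suc n) \<eta>"
    using exists_shortest by blast
  define \<Delta> where "\<Delta> = route_length \<sigma>' (Suc n) \<eta> - route_length \<sigma> n \<xi>"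
  have "\<bar>s\<bar> = 1"
    by (simp add: s_def)
  have "\<bar>\<Delta> - mean_hop\<bar> \<le> 2 * \<rho>"
    using route_length_extend[OF \<sigma> \<xi> \<open>\<bar>s\<bar> = 1\<close> \<eta>[unfolded \<sigma>'_def]] by (simp add: \<Delta>_def \<sigma>'_def)
  then have \<Delta>: "1 \<le> \<Delta>" "\<Delta> \<le> mean_hop + 2 * \<rho>"
    using mean_hop_ge \<rho>_bound by linarith+
  have "\<bar>r * \<Delta>\<bar> \<le> \<bar>r\<bar> * (mean_hop + 2 * \<rho>)"
    unfolding abs_mult using \<Delta> by (intro mult_left_mono) auto
  then have rd: "\<bar>r * \<Delta>\<bar> \<le> real N / 2"
    using r by linarith
  have "(\<Sum>i<Suc n. \<sigma>' i) = (\<Sum>i<n. \<sigma> i) + s"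
    by (simp add: \<sigma>'_def)
  then have "real N / 2 * of_int (\<Sum>i<Suc n. \<sigma>' i) - r * route_length \<sigma>' (Suc n) \<eta>
      = e + of_int s * (real N / 2) - r * \<Delta>"
    by (simp only: e_def \<Delta>_def) (simp add: algebra_simps)
  moreover have "\<bar>e + of_int s * (real N / 2) - r * \<Delta>\<bar> \<le> real N"
    using rd E[folded e_def] by (auto simp: s_def)
  moreover have "real (Suc n) \<le> route_length \<sigma>' (Suc n) \<eta>"
    using n \<Delta>(1) by (simp add: \<Delta>_def)
  moreover have "\<forall>i. \<bar>\<sigma>' i\<bar> = 1"
    using \<sigma> \<open>\<bar>s\<bar> = 1\<close> by (simp add: \<sigma>'_def)
  ultimately show ?case
    using \<eta> by (intro exI[of _ \<sigma>'] exI[of _ \<eta>]) simp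
qed

lemma rotation_number_attained:
  assumes r: "\<bar>r\<bar> * (mean_hop + 2 * \<rho>) \<le> real N / 2" and z: "z \<in> interior A"
  shows "r \<in> admissible_rotation_set A z"
proof -
  have "\<exists>d t. (\<exists>\<gamma> ks. square_trajectory A t \<gamma> \<and> admissible A ks \<and> has_type A t \<gamma> ks \<and> displacement z t \<gamma> d)
      \<and> real (Suc n) \<le> t \<and> \<bar>d - r * t\<bar> \<le> real N + 1" for n
  proof -
    obtain \<sigma> \<xi> where \<sigma>: "\<And>i. \<bar>\<sigma> i\<bar> = 1" and \<xi>: "shortest \<sigma> (Suc n) \<xi>"
      and len: "real (Suc n) \<le> route_length \<sigma> (Suc n) \<xi>"
      and E: "\<bar>real N / 2 * of_int (\<Sum>i<Suc n. \<sigma> i) - r * route_length \<sigma> (Suc n) \<xi>\<bar> \<le> real N"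
      using greedy_route[OF r] by blast
    obtain d where d: "displacement z (route_length \<sigma> (Suc n) \<xi>) (route \<sigma> (Suc n) \<xi>) d"
        "\<bar>d - real N / 2 * of_int (\<Sum>i<Suc n. \<sigma> i)\<bar> < 1"
      using route_displacement[OF \<xi> zero_less_Suc \<sigma> z] by blast
    have "\<bar>d - r * route_length \<sigma> (Suc n) \<xi>\<bar> \<le> real N + 1"
      using E d(2) by linarith
    then show ?thesis
      using route_trajectory[OF \<xi> zero_less_Suc \<sigma>] zigzag_admissible[of \<sigma>, OF \<sigma>] d(1) len by blast
  qed
  then obtain d t :: "nat \<Rightarrow> real" where
      tr: "\<And>n. \<exists>\<gamma> ks. square_trajectory A (t n) \<gamma> \<and> admissible A ks \<and> has_type A (t n) \<gamma> ks \<and> displacement z (t n) \<gamma> (d n)"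
      and t: "\<And>n. real (Suc n) \<le> t n" and dt: "\<And>n. \<bar>d n - r * t n\<bar> \<le> real N + 1"
    by metis
  have "filterlim t at_top sequentially"
  proof (rule filterlim_at_top_mono[OF filterlim_real_sequentially always_eventually], rule allI)
    fix n
    show "real n \<le> t n"
      using t[of n] by simp
  qed
  moreover have "(\<lambda>n. d n / t n) \<longlonglongrightarrow> r"
  proof (rule LIM_zero_cancel, rule tendsto_rabs_zero_cancel,
      rule tendsto_sandwich[where f = "\<lambda>_. 0" and h = "\<lambda>n. (real N + 1) * inverse (real (Suc n))"])
    show "(\<lambda>n. (real N + 1) * inverse (real (Suc n))) \<longlonglongrightarrow> 0"
      using tendsto_mult_right_zero[OF LIMSEQ_inverse_real_of_nat] by auto
    show "\<forall>\<^sub>F n in sequentially. \<bar>d n / t n - r\<bar> \<le> (real N + 1) * inverse (real (Suc n))"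
    proof (intro always_eventually allI)
      fix n
      have "0 < real (Suc n)" by simp
      then have "0 < t n" using t[of n] by linarith
      then have "d n / t n - r = (d n - r * t n) / t n"
        by (simp add: field_simps)
      then have "\<bar>d n / t n - r\<bar> = \<bar>d n - r * t n\<bar> / t n"
        using \<open>0 < t n\<close> by (simp only: abs_divide abs_of_pos)
      also have "\<dots> \<le> (real N + 1) / real (Suc n)"
        using dt[of n] t[of n] by (intro frac_le) auto
      finally show "\<bar>d n / t n - r\<bar> \<le> (real N + 1) * inverse (real (Suc n))"
        by (simp add: divide_inverse)
    qed
  qed (auto simp: always_eventually)
  ultimately show ?thesis
    unfolding admissible_rotation_set_def using tr by blast
qed

end

theorem theorem5p7:
  shows "\<forall>\<epsilon>::real. \<epsilon> > 0 \<longrightarrow> (\<exists>\<delta>::real. \<delta> > 0 \<and>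
    (\<forall>A z. obstacle A \<longrightarrow> z \<in> interior A \<longrightarrow>
       (\<exists>\<rho>. 2 * \<rho> < \<delta> \<and> A \<subseteq> cball 0 \<rho>) \<longrightarrow>
       {- sqrt 2 / 4 + \<epsilon> .. sqrt 2 / 4 - \<epsilon>} \<subseteq> admissible_rotation_set A z))"
proof (intro allI impI)
  fix \<epsilon> :: real assume "\<epsilon> > 0"
  \<comment> \<open>the slack \<open>\<epsilon>\<close> in the rate, over a hop of length about \<open>\<surd>2 N\<close>, has to make
    up for the bounded difference between \<open>\<surd>2 / 4\<close> times the length and \<open>N / 2\<close>\<close>
  define N where "N = 2 * (nat \<lceil>1 / \<epsilon>\<rceil> + 1)"
  have "1 / \<epsilon> \<le> real (nat \<lceil>1 / \<epsilon>\<rceil>)"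
    by (rule real_nat_ceiling_ge)
  then have "1 / \<epsilon> \<le> real N"
    by (simp add: N_def)
  then have N: "1 \<le> \<epsilon> * real N"
    using \<open>\<epsilon> > 0\<close> by (simp add: field_simps)
  show "\<exists>\<delta>::real. \<delta> > 0 \<and>
    (\<forall>A z. obstacle A \<longrightarrow> z \<in> interior A \<longrightarrow>
       (\<exists>\<rho>. 2 * \<rho> < \<delta> \<and> A \<subseteq> cball 0 \<rho>) \<longrightarrow>
       {- sqrt 2 / 4 + \<epsilon> .. sqrt 2 / 4 - \<epsilon>} \<subseteq> admissible_rotation_set A z)"
  proof (intro exI[of _ "1 / (8 * (real N + 2))"] conjI allI impI subsetI)
    fix A :: "complex set" and z r
    assume A: "obstacle A" "z \<in> interior A"
      and "\<exists>\<rho>. 2 * \<rho> < 1 / (8 * (real N + 2)) \<and> A \<subseteq> cball 0 \<rho>"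
      and r: "r \<in> {- sqrt 2 / 4 + \<epsilon> .. sqrt 2 / 4 - \<epsilon>}"
    then obtain \<rho> where \<rho>: "2 * \<rho> < 1 / (8 * (real N + 2))" "A \<subseteq> cball 0 \<rho>"
      by blast
    interpret tiny_obstacle A N \<rho>
      using A \<rho> unfolding obstacle_def by unfold_locales (auto simp: N_def field_simps)
    have "mean_hop \<le> sqrt 2 * (real N + 1)"
      unfolding mean_hop_def
      by (intro real_le_lsqrt) (auto simp: power_mult_distrib power2_sum)
    then have le: "mean_hop + 2 * \<rho> \<le> sqrt 2 * (real N + 1) + 1"
      using \<rho>_bound by linarith
    have "1 \<le> sqrt (2::real)"
      by simp
    have "\<bar>r\<bar> \<le> sqrt 2 / 4 - \<epsilon>"
      using r by auto
    then have "\<bar>r\<bar> * (mean_hop + 2 * \<rho>) \<le> (sqrt 2 / 4 - \<epsilon>) * (sqrt 2 * (real N + 1) + 1)"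
      using le mean_hop_ge \<rho>_nonneg by (intro mult_mono) auto
    also have "\<dots> = (real N + 1) / 2 + sqrt 2 / 4 - sqrt 2 * (\<epsilon> * real N) - sqrt 2 * \<epsilon> - \<epsilon>"
      by (simp add: field_simps)
    also have "\<dots> \<le> real N / 2"
    proof -
      have "sqrt 2 * 1 \<le> sqrt 2 * (\<epsilon> * real N)"
        using N by (intro mult_left_mono) auto
      then have "sqrt 2 \<le> sqrt 2 * (\<epsilon> * real N)"
        by (simp only: mult_1_right)
      moreover have "0 < sqrt 2 * \<epsilon>"
        using \<open>\<epsilon> > 0\<close> by simp
      moreover have "(real N + 1) / 2 + q / 4 - x - y - \<epsilon> \<le> real N / 2"
        if "1 \<le> q" "q \<le> x" "0 < y" for q x y
        using that \<open>\<epsilon> > 0\<close> by (simp add: add_divide_distrib)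
      ultimately show ?thesis
        using \<open>1 \<le> sqrt 2\<close> by blast
    qed
    finally show "r \<in> admissible_rotation_set A z"
      using A(2) by (rule rotation_number_attained)
  qed simp
qed

end
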